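(* Let $k\ge1$ be an integer with $k\le 2d_0^2/(\lambda\bar\varepsilon)$, let $x_0=\hat x_{k-1}$ be the prox center of the $k$-th cycle of PDPB$(\hat x_0,\lambda,\bar\varepsilon)$, and let $z_1=f'(x_0)$. Let $\{z_j\}$, $\{\bar z_j\}$ be generated by the conditional gradient method CG$(z_1)$ for $\min_z\psi(z)$ with weights $\tau_j$ chosen either as $\tau_j=\alpha_j$ for all $j$, or as $\tau_j=\beta_j$ for all $j$, where $$\alpha_j=\max\left\{0,\,1-\frac{S(z_j)}{\lambda\|z_j-\bar z_j\|^2}\right\},\qquad \beta_j\in\operatorname{Argmin}\{\psi(\beta z_j+(1-\beta)\bar z_j):\beta\in[0,1]\}.$$ Let $x_j=\nabla(h^\lambda)^*(-z_j)$ and define $u_1=x_1$ and $u_{j+1}=\frac{j}{j+2}u_j+\frac{2}{j+2}x_j$ for $j\ge1$. Then for every $j\ge1$, $$\phi^\lambda(u_j)+\psi(z_j)\le\frac{8M(3d_0+\lambda M)}{j(j+1)}+\frac{8\lambda M^2}{j+1}.$$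
   Context: Problem. $f,h:\mathbb R^n\to\mathbb R\cup\{+\infty\}$ are proper lower semicontinuous convex functions with $\operatorname{dom}h\subset\operatorname{dom}f$, and $\phi=f+h$. Assumptions: there is a map $f':\operatorname{dom}h\to\mathbb R^n$ with $f'(x)\in\partial f(x)$ for all $x\in\operatorname{dom}h$; $\|f'(x)\|\le M$ for all $x\in\operatorname{dom}h$, for some $M>0$; the set $X_*$ of minimizers of $\phi$ is nonempty. Write $\ell_f(u;y)=f(y)+\langle f'(y),u-y\rangle$; $g^*$ is the convex conjugate of $g$. For $\hat x_0\in\operatorname{dom}h$ let $d_0=\min\{\|x_*-\hat x_0\|:x_*\in X_*\}$; $\lambda,\bar\varepsilon>0$. For a prox center $x_0\in\operatorname{dom}h$ let $h^\lambda(u)=h(u)+\frac1{2\lambda}\|u-x_0\|^2$, $\phi^\lambda=f+h^\lambda$, $\psi(z)=(h^\lambda)^*(-z)+f^*(z)$. PDCP$(x_0,\lambda,\varepsilon)$ (primal-dual cutting-plane): start with $\Gamma_1=\ell_f(\cdot;x_0)$. For $j=1,2,\dots$: $x_j=\operatorname{argmin}_u\{\Gamma_j(u)+h^\lambda(u)\}$ with minimum value $m_j$, and $s_j\in\partial\Gamma_j(x_j)\cap(-\partial h^\lambda(x_j))$; a point $\tilde x_j$ is chosen with $\tilde x_1=x_1$ and $\phi^\lambda(\tilde x_j)\le\tau_{j-1}\phi^\lambda(\tilde x_{j-1})+(1-\tau_{j-1})\phi^\lambda(x_j)$ for $j\ge2$; $t_j=\phi^\lambda(\tilde x_j)-m_j$;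 $\tau_j\in[0,1]$ is selected and $\Gamma_{j+1}$ is any proper lower semicontinuous convex function with $\Gamma_{j+1}\le f$ and $\Gamma_{j+1}\ge\tau_j\bar\Gamma_j+(1-\tau_j)\ell_f(\cdot;x_j)$ for some proper lower semicontinuous convex $\bar\Gamma_j\le f$ with $\bar\Gamma_j(x_j)=\Gamma_j(x_j)$ and $x_j=\operatorname{argmin}_u\{\bar\Gamma_j(u)+h^\lambda(u)\}$. It stops at the first $j$ with $t_j\le\varepsilon$ and returns $(x_j,\tilde x_j,s_j)$. PDPB$(\hat x_0,\lambda,\bar\varepsilon)$: for $k=1,2,\dots$, $(\hat x_k,\tilde x_k,s_k)=\text{PDCP}(\hat x_{k-1},\lambda,\bar\varepsilon)$. CG$(z_1)$: for $j\ge1$, $\bar z_j\in\operatorname{argmin}_z\{\langle-\nabla(h^\lambda)^*(-z_j),z\rangle+f^*(z)\}$ and $z_{j+1}=\tau_jz_j+(1-\tau_j)\bar z_j$; the set of minimizers is $\partial f(\nabla(h^\lambda)^*(-z_j))$ and the minimizer selected is $\bar z_j=f'(\nabla(h^\lambda)^*(-z_j))$. Wolfe gap: $S(w)=\max_{z\in\mathbb R^n}\{-\langle\nabla(h^\lambda)^*(-w),w-z\rangle+f^*(w)-f^*(z)\}$. If $z_j=\bar z_j$ (in which case $z_{j+1}=z_j$ for any weight), $\alpha_j$ is any value in $[0,1]$. *)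

theory Defs
  imports "HOL-Analysis.Analysis"
begin

text \<open>
  Functions with values in \<open>\<real> \<union> {+\<infinity>}\<close> are modelled as \<^typ>\<open>ereal\<close>-valued functions;
  properness excludes the value \<open>-\<infinity>\<close>. Whenever a product with \<open>+\<infinity>\<close> occurs below, the
  convention \<open>0 * \<infinity> = 0\<close> of \<^typ>\<open>ereal\<close> applies.
\<close>

definition eff_dom :: "('a \<Rightarrow> ereal) \<Rightarrow> 'a set" where
  "eff_dom g = {x. g x < \<infinity>}"

definition proper_fun :: "('a \<Rightarrow> ereal) \<Rightarrow> bool" where
  "proper_fun g \<longleftrightarrow> (\<forall>x. g x \<noteq> -\<infinity>) \<and> eff_dom g \<noteq> {}"

definition convex_fun :: "('a::real_vector \<Rightarrow> ereal) \<Rightarrow> bool" where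
  "convex_fun g \<longleftrightarrow> (\<forall>x y. \<forall>t::real. 0 \<le> t \<and> t \<le> 1 \<longrightarrow>
     g ((1 - t) *\<^sub>R x + t *\<^sub>R y) \<le> ereal (1 - t) * g x + ereal t * g y)"

definition lsc_fun :: "('a::topological_space \<Rightarrow> ereal) \<Rightarrow> bool" where
  "lsc_fun g \<longleftrightarrow> (\<forall>x. g x \<le> Liminf (at x) g)"

definition proper_lsc_convex :: "('a::euclidean_space \<Rightarrow> ereal) \<Rightarrow> bool" where
  "proper_lsc_convex g \<longleftrightarrow> proper_fun g \<and> lsc_fun g \<and> convex_fun g"

definition subdiff :: "('a::real_inner \<Rightarrow> ereal) \<Rightarrow> 'a \<Rightarrow> 'a set" where
  "subdiff g x = {v. \<forall>u. g x + ereal (v \<bullet> (u - x)) \<le> g u}"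

definition conjugate :: "('a::real_inner \<Rightarrow> ereal) \<Rightarrow> 'a \<Rightarrow> ereal" where
  "conjugate g z = (SUP u. ereal (z \<bullet> u) - g u)"

definition Argmin :: "('a \<Rightarrow> ereal) \<Rightarrow> 'a set \<Rightarrow> 'a set" where
  "Argmin g C = {x. is_arg_min g (\<lambda>u. u \<in> C) x}"

text \<open>The gradient, at a point near which the function is finite.\<close>

definition grad :: "('a::real_inner \<Rightarrow> ereal) \<Rightarrow> 'a \<Rightarrow> 'a" where
  "grad g x = (THE v. (\<forall>\<^sub>F y in nhds x. \<bar>g y\<bar> \<noteq> \<infinity>) \<and>
     GDERIV (\<lambda>y. real_of_ereal (g y)) x :> v)"

text \<open>\<open>linz f f' y\<close> is \<open>\<ell>\<^sub>f(\<cdot>; y)\<close>, and \<open>prox_reg h \<lambda> x0\<close> is \<open>h\<^sup>\<lambda>\<close> with prox center \<open>x0\<close>.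
  The subgradient selection \<open>f'\<close> is a total function of which only the values on
  \<open>eff_dom h\<close> matter.\<close>

definition linz :: "('a::real_inner \<Rightarrow> ereal) \<Rightarrow> ('a \<Rightarrow> 'a) \<Rightarrow> 'a \<Rightarrow> 'a \<Rightarrow> ereal" where
  "linz f f' y u = f y + ereal (f' y \<bullet> (u - y))"

definition prox_reg :: "('a::real_inner \<Rightarrow> ereal) \<Rightarrow> real \<Rightarrow> 'a \<Rightarrow> 'a \<Rightarrow> ereal" where
  "prox_reg h lam x0 u = h u + ereal (1 / (2 * lam) * (norm (u - x0))\<^sup>2)"

definition prox_obj ::
  "('a::real_inner \<Rightarrow> ereal) \<Rightarrow> ('a \<Rightarrow> ereal) \<Rightarrow> real \<Rightarrow> 'a \<Rightarrow> 'a \<Rightarrow> ereal" where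
  "prox_obj f h lam x0 u = f u + prox_reg h lam x0 u"

definition dual_obj ::
  "('a::real_inner \<Rightarrow> ereal) \<Rightarrow> ('a \<Rightarrow> ereal) \<Rightarrow> real \<Rightarrow> 'a \<Rightarrow> 'a \<Rightarrow> ereal" where
  "dual_obj f h lam x0 z = conjugate (prox_reg h lam x0) (- z) + conjugate f z"

text \<open>\<open>pdcp_model_update f g f' x \<tau> \<Gamma> \<Gamma>'\<close>: the model \<open>\<Gamma>'\<close> is an admissible successor of \<open>\<Gamma>\<close>,
  where \<open>g\<close> is \<open>h\<^sup>\<lambda>\<close> and \<open>x\<close> is the current iterate.\<close>

definition pdcp_model_update ::
  "('a::euclidean_space \<Rightarrow> ereal) \<Rightarrow> ('a \<Rightarrow> ereal) \<Rightarrow> ('a \<Rightarrow> 'a) \<Rightarrow> 'a \<Rightarrow> real \<Rightarrow>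
    ('a \<Rightarrow> ereal) \<Rightarrow> ('a \<Rightarrow> ereal) \<Rightarrow> bool" where
  "pdcp_model_update f g f' x \<tau> \<Gamma> \<Gamma>' \<longleftrightarrow>
     proper_lsc_convex \<Gamma>' \<and> (\<forall>u. \<Gamma>' u \<le> f u) \<and>
     (\<exists>\<Gamma>b. proper_lsc_convex \<Gamma>b \<and> (\<forall>u. \<Gamma>b u \<le> f u) \<and> \<Gamma>b x = \<Gamma> x \<and>
        Argmin (\<lambda>u. \<Gamma>b u + g u) UNIV = {x} \<and>
        (\<forall>u. \<Gamma>' u \<ge> ereal \<tau> * \<Gamma>b u + ereal (1 - \<tau>) * linz f f' x u))"

text \<open>\<open>pdcp_returns f h f' x0 \<lambda> \<epsilon> xo xto so\<close>: some admissible run of the primal-dual cutting-plane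
  method from \<open>x0\<close> stops, at iteration \<open>J\<close>, and returns \<open>(xo, xto, so)\<close>. The difference in
  \<open>t j\<close> is \<open>\<phi>\<^sup>\<lambda>(xt j) - m\<^sub>j\<close>.\<close>

definition pdcp_returns ::
  "('a::euclidean_space \<Rightarrow> ereal) \<Rightarrow> ('a \<Rightarrow> ereal) \<Rightarrow> ('a \<Rightarrow> 'a) \<Rightarrow> 'a \<Rightarrow> real \<Rightarrow> real \<Rightarrow>
    'a \<Rightarrow> 'a \<Rightarrow> 'a \<Rightarrow> bool" where
  "pdcp_returns f h f' x0 lam eps xo xto so \<longleftrightarrow>
     (\<exists>(\<Gamma> :: nat \<Rightarrow> 'a \<Rightarrow> ereal) (x :: nat \<Rightarrow> 'a) (xt :: nat \<Rightarrow> 'a) (s :: nat \<Rightarrow> 'a)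
        (\<tau> :: nat \<Rightarrow> real) (t :: nat \<Rightarrow> ereal) (J :: nat).
        J \<ge> 1 \<and>
        \<Gamma> 1 = linz f f' x0 \<and>
        (\<forall>j\<in>{1..J}. Argmin (\<lambda>u. \<Gamma> j u + prox_reg h lam x0 u) UNIV = {x j}) \<and>
        (\<forall>j\<in>{1..J}. s j \<in> subdiff (\<Gamma> j) (x j) \<inter> uminus ` subdiff (prox_reg h lam x0) (x j)) \<and>
        xt 1 = x 1 \<and>
        (\<forall>j\<in>{2..J}. prox_obj f h lam x0 (xt j) \<le>
           ereal (\<tau> (j - 1)) * prox_obj f h lam x0 (xt (j - 1)) +
           ereal (1 - \<tau> (j - 1)) * prox_obj f h lam x0 (x j)) \<and>
        (\<forall>j\<in>{1..J}. t j = prox_obj f h lam x0 (xt j) - (\<Gamma> j (x j) + prox_reg h lam x0 (x j))) \<and>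
        (\<forall>j\<in>{1..<J}. \<tau> j \<in> {0..1} \<and>
           pdcp_model_update f (prox_reg h lam x0) f' (x j) (\<tau> j) (\<Gamma> j) (\<Gamma> (Suc j))) \<and>
        (\<forall>j\<in>{1..<J}. t j > ereal eps) \<and> t J \<le> ereal eps \<and>
        xo = x J \<and> xto = xt J \<and> so = s J)"

text \<open>The first \<open>K\<close> cycles of the primal-dual proximal bundle method; \<open>xh i\<close> is the prox center
  of cycle \<open>i + 1\<close>.\<close>

definition pdpb_run ::
  "('a::euclidean_space \<Rightarrow> ereal) \<Rightarrow> ('a \<Rightarrow> ereal) \<Rightarrow> ('a \<Rightarrow> 'a) \<Rightarrow> 'a \<Rightarrow> real \<Rightarrow> real \<Rightarrow> nat \<Rightarrow>
    (nat \<Rightarrow> 'a) \<Rightarrow> (nat \<Rightarrow> 'a) \<Rightarrow> (nat \<Rightarrow> 'a) \<Rightarrow> bool" where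
  "pdpb_run f h f' xhat0 lam eps K xh xt s \<longleftrightarrow>
     xh 0 = xhat0 \<and>
     (\<forall>i\<in>{1..K}. pdcp_returns f h f' (xh (i - 1)) lam eps (xh i) (xt i) (s i))"

definition cg_run ::
  "('a::euclidean_space \<Rightarrow> ereal) \<Rightarrow> ('a \<Rightarrow> ereal) \<Rightarrow> ('a \<Rightarrow> 'a) \<Rightarrow> real \<Rightarrow> 'a \<Rightarrow> 'a \<Rightarrow>
    (nat \<Rightarrow> real) \<Rightarrow> (nat \<Rightarrow> 'a) \<Rightarrow> (nat \<Rightarrow> 'a) \<Rightarrow> bool" where
  "cg_run f h f' lam x0 z1 \<tau> z zb \<longleftrightarrow>
     z 1 = z1 \<and>
     (\<forall>j\<ge>1.
        zb j \<in> Argmin (\<lambda>w. ereal ((- grad (conjugate (prox_reg h lam x0)) (- z j)) \<bullet> w)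
                        + conjugate f w) UNIV \<and>
        zb j = f' (grad (conjugate (prox_reg h lam x0)) (- z j)) \<and>
        z (Suc j) = \<tau> j *\<^sub>R z j + (1 - \<tau> j) *\<^sub>R zb j)"

text \<open>The Wolfe gap at \<open>w\<close>. It is only used at points of the domain of \<open>f\<^sup>*\<close> with a nonempty
  set of minimizers in the linear subproblem, where the supremum is a maximum.\<close>

definition wolfe_gap ::
  "('a::real_inner \<Rightarrow> ereal) \<Rightarrow> ('a \<Rightarrow> ereal) \<Rightarrow> real \<Rightarrow> 'a \<Rightarrow> 'a \<Rightarrow> ereal" where
  "wolfe_gap f h lam x0 w =
     (SUP z. ereal (- (grad (conjugate (prox_reg h lam x0)) (- w) \<bullet> (w - z)))
             + conjugate f w - conjugate f z)"

definition alpha_weight ::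
  "('a::real_inner \<Rightarrow> ereal) \<Rightarrow> ('a \<Rightarrow> ereal) \<Rightarrow> real \<Rightarrow> 'a \<Rightarrow> 'a \<Rightarrow> 'a \<Rightarrow> real \<Rightarrow> bool" where
  "alpha_weight f h lam x0 z zb a \<longleftrightarrow>
     (if z = zb then a \<in> {0..1}
      else ereal a = max 0 (1 - wolfe_gap f h lam x0 z / ereal (lam * (norm (z - zb))\<^sup>2)))"

definition beta_weight ::
  "('a::real_inner \<Rightarrow> ereal) \<Rightarrow> ('a \<Rightarrow> ereal) \<Rightarrow> real \<Rightarrow> 'a \<Rightarrow> 'a \<Rightarrow> 'a \<Rightarrow> real \<Rightarrow> bool" where
  "beta_weight f h lam x0 z zb b \<longleftrightarrow>
     b \<in> Argmin (\<lambda>c. dual_obj f h lam x0 (c *\<^sub>R z + (1 - c) *\<^sub>R zb)) {0..1}"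

end

theory Submission
  imports Defs
begin

text \<open>
  The quantity bounded by the theorem is a primal-dual gap, and the argument is the standard
  analysis of the conditional gradient method, carried out on the dual problem.

  The regularized function \<open>h\<^sup>\<lambda>\<close> is strongly convex with modulus \<open>1/\<lambda>\<close>, so its conjugate is finite
  and has a \<open>\<lambda>\<close>-Lipschitz gradient; \<open>x\<^sub>j = \<nabla>(h\<^sup>\<lambda>)\<^sup>*(-z\<^sub>j)\<close> is the point where \<open>-z\<^sub>j\<close> is a subgradient
  of \<open>h\<^sup>\<lambda>\<close> (\<open>prox_pair_grad\<close>). By the equality case of the Fenchel-Young inequality, the Wolfe gap
  \<open>S(z\<^sub>j)\<close> equals \<open>\<phi>\<^sup>\<lambda>(x\<^sub>j) + \<psi>(z\<^sub>j)\<close>. Smoothness of \<open>(h\<^sup>\<lambda>)\<^sup>*\<close> and convexity of \<open>f\<^sup>*\<close> bound \<open>\<psi>\<close> at parameter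
  \<open>c\<close> on the segment from \<open>z\<^sub>j\<close> to the next vertex by
  \<open>\<psi>(z\<^sub>j) - c S(z\<^sub>j) + c\<^sup>2 \<lambda>/2 \<parallel>z\<^sub>j - \<zeta>\<^sub>j\<parallel>\<^sup>2\<close>, where \<open>\<zeta>\<^sub>j = f'(x\<^sub>j)\<close> is that vertex. The weight \<open>\<alpha>\<^sub>j\<close> minimizes
  this quadratic over \<open>[0,1]\<close> and \<open>\<beta>\<^sub>j\<close> minimizes \<open>\<psi>\<close> itself, so with either choice \<open>\<psi>(z\<^sub>j\<^sub>+\<^sub>1)\<close> is at most
  the value of the quadratic at every \<open>c\<close> (\<open>cg_weight_model_optimal\<close>), in particular at
  \<open>c = 2/(j+2)\<close>, which is the weight that \<open>u\<^sub>j\<^sub>+\<^sub>1\<close> gives to \<open>x\<^sub>j\<close>. Adding convexity of \<open>\<phi>\<^sup>\<lambda>\<close> along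
  \<open>u\<^sub>j\<close>, the term \<open>\<phi>\<^sup>\<lambda>(x\<^sub>j)\<close> cancels, and since both dual points have norm at most \<open>M\<close>,
  \<open>g\<^sub>j\<^sub>+\<^sub>1 \<le> (1 - c) g\<^sub>j + 2 \<lambda> M\<^sup>2 c\<^sup>2\<close> holds for \<open>g\<^sub>j = \<phi>\<^sup>\<lambda>(u\<^sub>j) + \<psi>(z\<^sub>j)\<close>. Multiplying by \<open>(j+1)(j+2)\<close> makes
  this telescope (\<open>gap_recursion_bound\<close>), leaving \<open>g\<^sub>1\<close> to be estimated.

  The first gap is the linearization error of \<open>f\<close> at \<open>x\<^sub>0\<close>, evaluated at \<open>x\<^sub>1\<close>. It is at most
  \<open>2 M \<parallel>x\<^sub>1 - x\<^sub>0\<parallel>\<close>, and \<open>\<parallel>x\<^sub>1 - x\<^sub>0\<parallel> \<le> \<parallel>y - x\<^sub>0\<parallel> + 2 \<lambda> M\<close> for every minimizer \<open>y\<close> of \<open>\<phi>\<close>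
  (\<open>first_gap_bound\<close>). Finally each cycle of the bundle method increases the squared distance to \<open>y\<close>
  by at most \<open>2 \<lambda> \<epsilon>\<close> (\<open>pdcp_returns_fejer\<close>). The bound on \<open>k\<close> turns the total increase into at
  most \<open>4 d\<^sub>0\<^sup>2\<close>, so the prox center of the \<open>k\<close>-th cycle stays within \<open>3 d\<^sub>0\<close> of a suitable minimizer.
\<close>

section \<open>Convexity and quadratic growth at prox points\<close>

lemma sqnorm_convex_combination:
  fixes x y a :: "'a::real_inner"
  shows "(norm ((1 - t) *\<^sub>R x + t *\<^sub>R y - a))\<^sup>2
       = (1 - t) * (norm (x - a))\<^sup>2 + t * (norm (y - a))\<^sup>2 - t * (1 - t) * (norm (y - x))\<^sup>2"
  unfolding power2_norm_eq_inner
  by (simp add: inner_left_distrib inner_right_distrib inner_diff_left inner_diff_right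
      inner_commute algebra_simps)

lemma convex_fun_add:
  fixes f g :: "'a::real_vector \<Rightarrow> ereal"
  assumes "convex_fun f" "convex_fun g"
  shows "convex_fun (\<lambda>u. f u + g u)"
  unfolding convex_fun_def
proof (intro allI impI)
  fix x y :: 'a and t :: real
  assume t: "0 \<le> t \<and> t \<le> 1"
  let ?p = "(1 - t) *\<^sub>R x + t *\<^sub>R y"
  have "f ?p + g ?p \<le> (ereal (1 - t) * f x + ereal t * f y) + (ereal (1 - t) * g x + ereal t * g y)"
    using assms t unfolding convex_fun_def by (intro add_mono) blast+
  also have "\<dots> = ereal (1 - t) * (f x + g x) + ereal t * (f y + g y)"
    using t by (simp add: ereal_pos_distrib ac_simps)
  finally show "f ?p + g ?p \<le> ereal (1 - t) * (f x + g x) + ereal t * (f y + g y)" .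
qed

lemma convex_fun_add_real:
  fixes f :: "'a::real_vector \<Rightarrow> ereal"
  assumes "convex_fun f"
    and q: "\<And>x y t. 0 \<le> t \<Longrightarrow> t \<le> 1 \<Longrightarrow> q ((1 - t) *\<^sub>R x + t *\<^sub>R y) \<le> (1 - t) * q x + t * q y"
  shows "convex_fun (\<lambda>u. f u + ereal (q u))"
  by (rule convex_fun_add[OF assms(1)]) (simp add: convex_fun_def q)

lemma convex_fun_prox_reg:
  fixes h :: "'a::real_inner \<Rightarrow> ereal"
  assumes "convex_fun h" "lam > 0"
  shows "convex_fun (prox_reg h lam x0)"
  unfolding prox_reg_def
proof (rule convex_fun_add_real[OF assms(1)])
  fix x y :: 'a and t :: real
  assume t: "0 \<le> t" "t \<le> 1"
  have "(norm ((1 - t) *\<^sub>R x + t *\<^sub>R y - x0))\<^sup>2 \<le> (1 - t) * (norm (x - x0))\<^sup>2 + t * (norm (y - x0))\<^sup>2"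
    using t unfolding sqnorm_convex_combination by simp
  from mult_left_mono[OF this, of "1 / (2 * lam)"] assms(2)
  show "1 / (2 * lam) * (norm ((1 - t) *\<^sub>R x + t *\<^sub>R y - x0))\<^sup>2
      \<le> (1 - t) * (1 / (2 * lam) * (norm (x - x0))\<^sup>2) + t * (1 / (2 * lam) * (norm (y - x0))\<^sup>2)"
    by (simp add: algebra_simps add_divide_distrib diff_divide_distrib)
qed

text \<open>
  Compare the minimizer \<open>x\<close> with the point at parameter \<open>t\<close> on the segment towards \<open>u\<close>. The quadratic term contributes
  \<open>- t (1 - t) c \<parallel>u - x\<parallel>\<^sup>2\<close>; dividing by \<open>t\<close> and letting \<open>t\<close> tend to \<open>0\<close> gives the claim.
\<close>

lemma prox_minimizer_growth:
  fixes g :: "'a::real_inner \<Rightarrow> ereal"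
  assumes cvx: "convex_fun g" and fin: "\<And>v. g v \<noteq> -\<infinity>" "g x < \<infinity>"
    and min: "\<And>v. g x + ereal (c * (norm (x - a))\<^sup>2) \<le> g v + ereal (c * (norm (v - a))\<^sup>2)"
  shows "g x + ereal (c * (norm (x - a))\<^sup>2 + c * (norm (u - x))\<^sup>2) \<le> g u + ereal (c * (norm (u - a))\<^sup>2)"
proof (cases "g u")
  case (real gu)
  from fin obtain gx where gx: "g x = ereal gx" by (cases "g x") auto
  have *: "gx + c * (norm (x - a))\<^sup>2 + (1 - t) * (c * (norm (u - x))\<^sup>2) \<le> gu + c * (norm (u - a))\<^sup>2"
    if t: "0 < t" "t < 1" for t
  proof -
    let ?p = "(1 - t) *\<^sub>R x + t *\<^sub>R u"
    have "g ?p \<le> ereal (1 - t) * g x + ereal t * g u"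
      using cvx t unfolding convex_fun_def by auto
    then have p: "g ?p \<le> ereal ((1 - t) * gx + t * gu)" by (simp add: gx real)
    have "g x + ereal (c * (norm (x - a))\<^sup>2) \<le> g ?p + ereal (c * (norm (?p - a))\<^sup>2)" by (rule min)
    also have "\<dots> \<le> ereal ((1 - t) * gx + t * gu) + ereal (c * (norm (?p - a))\<^sup>2)"
      by (intro add_right_mono p)
    finally have "gx + c * (norm (x - a))\<^sup>2 \<le> (1 - t) * gx + t * gu + c * (norm (?p - a))\<^sup>2"
      by (simp add: gx)
    then have "t * (gx + c * (norm (x - a))\<^sup>2 + (1 - t) * (c * (norm (u - x))\<^sup>2))
        \<le> t * (gu + c * (norm (u - a))\<^sup>2)"
      unfolding sqnorm_convex_combination by (simp add: algebra_simps)
    then show ?thesis using t by simp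
  qed
  have "((\<lambda>t. gx + c * (norm (x - a))\<^sup>2 + (1 - t) * (c * (norm (u - x))\<^sup>2))
      \<longlongrightarrow> gx + c * (norm (x - a))\<^sup>2 + (1 - 0) * (c * (norm (u - x))\<^sup>2)) (at_right (0::real))"
    by (intro tendsto_intros)
  moreover have "\<forall>\<^sub>F t in at_right (0::real).
      gx + c * (norm (x - a))\<^sup>2 + (1 - t) * (c * (norm (u - x))\<^sup>2) \<le> gu + c * (norm (u - a))\<^sup>2"
    unfolding eventually_at_right_field using * by (intro exI[of _ 1]) auto
  ultimately have "gx + c * (norm (x - a))\<^sup>2 + (1 - 0) * (c * (norm (u - x))\<^sup>2)
      \<le> gu + c * (norm (u - a))\<^sup>2"
    by (intro tendsto_upperbound) auto
  then show ?thesis by (simp add: gx real)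
qed (use fin in auto)

section \<open>Existence of prox points\<close>

text \<open>
  The limit of a convergent subsequence of a minimizing sequence is a minimizer, because \<open>g\<close> is
  lower semicontinuous there. The continuous term \<open>q\<close> is carried along so that the result
  applies directly to \<open>h\<close> plus a quadratic.
\<close>

lemma lsc_attains_min:
  fixes g :: "'a::euclidean_space \<Rightarrow> ereal"
  assumes lsc: "lsc_fun g" and q: "continuous_on UNIV q" and K: "compact K" "K \<noteq> {}"
  shows "\<exists>x\<in>K. \<forall>u\<in>K. g x + ereal (q x) \<le> g u + ereal (q u)"
proof -
  let ?F = "\<lambda>u. ereal (q u) + g u"
  obtain y where y: "\<And>n. y n \<in> ?F ` K" "y \<longlonglongrightarrow> Inf (?F ` K)"
    using Inf_as_limit[of "?F ` K"] K(2) by auto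
  then have "\<forall>n. \<exists>v. v \<in> K \<and> y n = ?F v" by blast
  then obtain v where v: "\<And>n. v n \<in> K" "\<And>n. y n = ?F (v n)" by metis
  obtain l r where l: "l \<in> K" "strict_mono (r :: nat \<Rightarrow> nat)" "(v \<circ> r) \<longlonglongrightarrow> l"
    using K(1) v(1) unfolding compact_def by metis
  have gl: "g l \<le> liminf (\<lambda>n. g (v (r n)))"
    unfolding le_Liminf_iff
  proof (intro allI impI)
    fix c assume c: "c < g l"
    also have "g l \<le> Liminf (at l) g" using lsc unfolding lsc_fun_def by blast
    finally have "\<forall>\<^sub>F w in at l. c < g w" by (metis less_LiminfD)
    with c have "\<forall>\<^sub>F w in nhds l. c < g w"
      by (auto simp: eventually_nhds_conv_at)
    with l(3) show "\<forall>\<^sub>F n in sequentially. c < g (v (r n))"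
      by (auto simp: filterlim_iff o_def)
  qed
  have "(\<lambda>n. q (v (r n))) \<longlonglongrightarrow> q l"
    using continuous_on_tendsto_compose[OF q l(3)] by (simp add: o_def)
  then have ql: "(\<lambda>n. ereal (q (v (r n)))) \<longlonglongrightarrow> ereal (q l)" by simp
  have "?F l \<le> ereal (q l) + liminf (\<lambda>n. g (v (r n)))" by (intro add_left_mono gl)
  also have "\<dots> = liminf (\<lambda>n. ?F (v (r n)))" using ereal_liminf_lim_add[OF ql] by simp
  also have "\<dots> = Inf (?F ` K)"
  proof (rule lim_imp_Liminf)
    show "(\<lambda>n. ?F (v (r n))) \<longlonglongrightarrow> Inf (?F ` K)"
      using LIMSEQ_subseq_LIMSEQ[OF y(2) l(2)] v(2) by (simp add: o_def)
  qed simp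
  finally have "\<forall>u\<in>K. ?F l \<le> ?F u" by (meson INF_lower order_trans)
  with l(1) show ?thesis by (auto simp: add.commute)
qed

text \<open>
  Lower semicontinuity bounds \<open>h\<close> below by some \<open>m\<close> on the unit ball around a point \<open>p\<close> of its
  domain. Along the ray from \<open>p\<close> through \<open>u\<close>, convexity keeps \<open>h\<close> outside that ball above the line
  that has the value \<open>h(p)\<close> at \<open>p\<close> and \<open>m\<close> on the unit sphere, so \<open>K = h(p) - m\<close> works.
\<close>

lemma proper_lsc_convex_linear_minorant:
  fixes h :: "'a::euclidean_space \<Rightarrow> ereal"
  assumes "proper_lsc_convex h"
  obtains p hp K where "h p = ereal hp" "K \<ge> 0" "\<And>u. norm (u - p) \<ge> 1 \<Longrightarrow> ereal (hp - K * norm (u - p)) \<le> h u"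
proof -
  from assms have pr: "\<And>u. h u \<noteq> -\<infinity>" "eff_dom h \<noteq> {}" and lsc: "lsc_fun h" and cvx: "convex_fun h"
    by (auto simp: proper_lsc_convex_def proper_fun_def)
  from pr(2) obtain p where "h p < \<infinity>" by (auto simp: eff_dom_def)
  with pr(1)[of p] obtain hp where hp: "h p = ereal hp" by (cases "h p") auto
  obtain b where b: "b \<in> cball p 1" "\<And>u. u \<in> cball p 1 \<Longrightarrow> h b \<le> h u"
    using lsc_attains_min[OF lsc, of "\<lambda>_. 0" "cball p 1"] by auto
  have "h b \<le> h p" by (rule b(2)) simp
  with hp pr(1)[of b] obtain m where m: "h b = ereal m" by (cases "h b") auto
  from \<open>h b \<le> h p\<close> have mp: "m \<le> hp" by (simp add: m hp)
  have "ereal (hp - (hp - m) * norm (u - p)) \<le> h u" if u: "norm (u - p) \<ge> 1" for u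
  proof (cases "h u")
    case (real hu)
    define t where "t = 1 / norm (u - p)"
    have t: "0 < t" "t \<le> 1" using u by (auto simp: t_def divide_le_eq)
    let ?w = "(1 - t) *\<^sub>R p + t *\<^sub>R u"
    have up: "norm (u - p) > 0" using u by linarith
    have "?w = p + t *\<^sub>R (u - p)" by (simp add: algebra_simps)
    then have "dist p ?w = 1" using up by (simp add: dist_norm t_def)
    then have "ereal m \<le> h ?w" using b(2)[of ?w] m by simp
    also have "\<dots> \<le> ereal (1 - t) * h p + ereal t * h u"
      using cvx t unfolding convex_fun_def by auto
    finally have "m \<le> (1 - t) * hp + t * hu" by (simp add: hp real)
    then have "norm (u - p) * m \<le> norm (u - p) * ((1 - t) * hp + t * hu)" using up by simp
    also have "\<dots> = (norm (u - p) - 1) * hp + hu" using up by (simp add: t_def field_simps)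
    finally have "hp - (hp - m) * norm (u - p) \<le> hu" by (simp add: algebra_simps)
    then show ?thesis by (simp add: real)
  qed (use pr in auto)
  with hp mp show thesis by (intro that[of p hp "hp - m"]) auto
qed

text \<open>
  The quadratic dominates the linear minorant of \<open>h\<close> outside a large ball around \<open>p\<close>, so a
  minimizer over that ball is a global one.
\<close>

lemma prox_minimizer_exists:
  fixes h :: "'a::euclidean_space \<Rightarrow> ereal"
  assumes h: "proper_lsc_convex h" and c: "c > 0"
  shows "\<exists>x. h x < \<infinity> \<and> (\<forall>u. h x + ereal (c * (norm (x - a))\<^sup>2) \<le> h u + ereal (c * (norm (u - a))\<^sup>2))"
proof -
  obtain p hp K where hp: "h p = ereal hp" and K: "K \<ge> 0"
    and minor: "\<And>u. norm (u - p) \<ge> 1 \<Longrightarrow> ereal (hp - K * norm (u - p)) \<le> h u"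
    using proper_lsc_convex_linear_minorant[OF h] by blast
  \<comment> \<open>The radius comes from \<open>c (r - d)\<^sup>2 - K r \<ge> c d\<^sup>2\<close>, which with \<open>d = \<parallel>p - a\<parallel>\<close> holds for all
    \<open>r \<ge> 2 d + K / c\<close>; the maximum with \<open>1\<close> puts such points in the range of the minorant.\<close>
  define R where "R = max 1 (2 * norm (p - a) + K / c)"
  let ?F = "\<lambda>u. h u + ereal (c * (norm (u - a))\<^sup>2)"
  have "lsc_fun h" using h by (simp add: proper_lsc_convex_def)
  moreover have "continuous_on UNIV (\<lambda>u. c * (norm (u - a))\<^sup>2)" by (intro continuous_intros)
  ultimately obtain x where x: "x \<in> cball p R" "\<And>u. u \<in> cball p R \<Longrightarrow> ?F x \<le> ?F u"
    using lsc_attains_min[of h _ "cball p R"] by (force simp: R_def)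
  have xp: "?F x \<le> ?F p" by (rule x(2)) (simp add: R_def)
  have far: "?F p \<le> ?F u" if u: "u \<notin> cball p R" for u
  proof -
    let ?r = "norm (u - p)" and ?d = "norm (p - a)"
    have r: "?r > 1" "?r > 2 * ?d + K / c"
      using u by (auto simp: R_def dist_norm norm_minus_commute)
    have K': "K / c \<ge> 0" using K c by simp
    have "?r - ?d \<le> norm (u - a)" using norm_triangle_ineq2[of "u - p" "a - p"]
      by (simp add: norm_minus_commute)
    then have "(?r - ?d)\<^sup>2 \<le> (norm (u - a))\<^sup>2" using r(2) K' norm_ge_zero[of "p - a"]
      by (intro power_mono) linarith+
    then have "c * (?r - ?d)\<^sup>2 \<le> c * (norm (u - a))\<^sup>2" using c by simp
    moreover have "?r * (c * ?r) \<ge> ?r * (2 * c * ?d + K)"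
      using r c by (intro mult_left_mono) (auto simp: field_simps)
    ultimately have "hp + c * ?d\<^sup>2 \<le> hp - K * ?r + c * (norm (u - a))\<^sup>2"
      by (simp add: power2_eq_square algebra_simps)
    then have "?F p \<le> ereal (hp - K * ?r) + ereal (c * (norm (u - a))\<^sup>2)" by (simp add: hp)
    also have "\<dots> \<le> ?F u" using r by (intro add_right_mono minor) simp
    finally show ?thesis .
  qed
  have "?F x \<le> ?F u" for u using x(2) far xp by (meson order_trans)
  moreover have "h x < \<infinity>" using xp hp by (cases "h x") auto
  ultimately show ?thesis by blast
qed

section \<open>Conjugates\<close>

lemma fenchel_young: "ereal (v \<bullet> u) - g u \<le> conjugate g v"
  unfolding conjugate_def by (rule SUP_upper) simp

text \<open>
  The equality case of the Fenchel-Young inequality; it evaluates \<open>f\<^sup>*\<close> at every vertex chosen by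
  the method and \<open>(h\<^sup>\<lambda>)\<^sup>*\<close> at every iterate.
\<close>

lemma conjugate_at_subgradient:
  assumes "v \<in> subdiff g y" "g y = ereal gy"
  shows "conjugate g v = ereal (v \<bullet> y - gy)"
proof (rule antisym)
  show "conjugate g v \<le> ereal (v \<bullet> y - gy)"
    unfolding conjugate_def
  proof (rule SUP_least)
    fix u
    have "ereal (gy + v \<bullet> (u - y)) \<le> g u" using assms by (auto simp: subdiff_def)
    then show "ereal (v \<bullet> u) - g u \<le> ereal (v \<bullet> y - gy)"
      by (cases "g u") (auto simp: inner_diff_right)
  qed
  show "ereal (v \<bullet> y - gy) \<le> conjugate g v" using fenchel_young[of v y g] assms(2) by simp
qed

lemma conjugate_neq_MInf:
  assumes "g y < \<infinity>"
  shows "conjugate g v \<noteq> -\<infinity>"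
  using fenchel_young[of v y g] assms by (cases "g y") auto

lemma convex_fun_conjugate:
  fixes g :: "'a::real_inner \<Rightarrow> ereal"
  assumes "\<And>u. g u \<noteq> -\<infinity>"
  shows "convex_fun (conjugate g)"
  unfolding convex_fun_def
proof (intro allI impI)
  fix v w :: 'a and t :: real
  assume t: "0 \<le> t \<and> t \<le> 1"
  let ?p = "(1 - t) *\<^sub>R v + t *\<^sub>R w"
  show "conjugate g ?p \<le> ereal (1 - t) * conjugate g v + ereal t * conjugate g w"
    unfolding conjugate_def[of g ?p]
  proof (rule SUP_least)
    fix u
    have "ereal (?p \<bullet> u) - g u \<le> ereal (1 - t) * (ereal (v \<bullet> u) - g u) + ereal t * (ereal (w \<bullet> u) - g u)"
    proof (cases "g u")
      case (real r)
      then show ?thesis by (simp add: inner_add_left algebra_simps)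
    qed (use assms in auto)
    also have "\<dots> \<le> ereal (1 - t) * conjugate g v + ereal t * conjugate g w"
      using t by (intro add_mono ereal_mult_left_mono fenchel_young) auto
    finally show "ereal (?p \<bullet> u) - g u \<le> ereal (1 - t) * conjugate g v + ereal t * conjugate g w" .
  qed
qed

section \<open>The conjugate of the regularized function\<close>

text \<open>
  A subgradient \<open>w\<close> of \<open>h\<^sup>\<lambda>\<close> at \<open>x\<close> together with the quadratic growth that strong convexity adds to
  the subgradient inequality. Every estimate on \<open>(h\<^sup>\<lambda>)\<^sup>*\<close> and its gradient below is read off from
  this single inequality.
\<close>

definition prox_pair :: "('a::real_inner \<Rightarrow> ereal) \<Rightarrow> real \<Rightarrow> 'a \<Rightarrow> 'a \<Rightarrow> 'a \<Rightarrow> bool" where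
  "prox_pair h lam x0 w x \<longleftrightarrow> \<bar>h x\<bar> \<noteq> \<infinity> \<and>
     (\<forall>u. prox_reg h lam x0 x + ereal (w \<bullet> (u - x) + 1 / (2 * lam) * (norm (u - x))\<^sup>2)
          \<le> prox_reg h lam x0 u)"

text \<open>
  Completing the square absorbs the linear form \<open>w\<close> into the quadratic: up to a constant,
  \<open>h\<^sup>\<lambda> - \<langle>w, \<cdot>\<rangle>\<close> is the prox objective of \<open>h\<close> with center \<open>x0 + \<lambda> w\<close>, so \<open>x\<close> is the prox point there.
\<close>

lemma prox_pair_exists:
  fixes h :: "'a::euclidean_space \<Rightarrow> ereal"
  assumes h: "proper_lsc_convex h" and lam: "lam > 0"
  shows "\<exists>x. prox_pair h lam x0 w x"
proof -
  from h have ninf: "\<And>u. h u \<noteq> -\<infinity>" and cvx: "convex_fun h"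
    by (auto simp: proper_lsc_convex_def proper_fun_def)
  define c a where "c = 1 / (2 * lam)" and "a = x0 + lam *\<^sub>R w"
  have c: "c > 0" using lam by (simp add: c_def)
  obtain x where x: "h x < \<infinity>"
    "\<And>u. h x + ereal (c * (norm (x - a))\<^sup>2) \<le> h u + ereal (c * (norm (u - a))\<^sup>2)"
    using prox_minimizer_exists[OF h c] by blast
  from x(1) ninf[of x] obtain hx where hx: "h x = ereal hx" by (cases "h x") auto
  have square: "c * (norm (u - a))\<^sup>2 = c * (norm (u - x0))\<^sup>2 - w \<bullet> (u - x0) + lam / 2 * (norm w)\<^sup>2" for u
    using lam unfolding a_def c_def power2_norm_eq_inner
    by (simp add: inner_left_distrib inner_right_distrib inner_diff_left inner_diff_right
        inner_commute field_simps)
  have "prox_reg h lam x0 x + ereal (w \<bullet> (u - x) + c * (norm (u - x))\<^sup>2) \<le> prox_reg h lam x0 u" for u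
  proof (cases "h u")
    case (real hu)
    have "h x + ereal (c * (norm (x - a))\<^sup>2 + c * (norm (u - x))\<^sup>2) \<le> h u + ereal (c * (norm (u - a))\<^sup>2)"
      by (rule prox_minimizer_growth[OF cvx ninf x])
    then show ?thesis
      unfolding prox_reg_def c_def[symmetric] by (simp add: hx real square inner_diff_right)
  qed (use ninf in \<open>auto simp: prox_reg_def\<close>)
  then show ?thesis unfolding prox_pair_def c_def by (intro exI[of _ x]) (simp add: hx)
qed

lemma prox_pairE:
  assumes "prox_pair h lam x0 w x"
  obtains p where "prox_reg h lam x0 x = ereal p"
    "\<forall>u. ereal (p + w \<bullet> (u - x) + 1 / (2 * lam) * (norm (u - x))\<^sup>2) \<le> prox_reg h lam x0 u"
proof -
  from assms obtain hx where hx: "h x = ereal hx" unfolding prox_pair_def by (cases "h x") auto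
  show thesis
    using assms by (intro that[of "hx + 1 / (2 * lam) * (norm (x - x0))\<^sup>2"])
      (auto simp: prox_pair_def prox_reg_def hx add.assoc)
qed

lemma prox_pair_subgradient:
  assumes "prox_pair h lam x0 w x" "lam > 0"
  shows "w \<in> subdiff (prox_reg h lam x0) x"
proof -
  obtain p where p: "prox_reg h lam x0 x = ereal p"
    "\<forall>u. ereal (p + w \<bullet> (u - x) + 1 / (2 * lam) * (norm (u - x))\<^sup>2) \<le> prox_reg h lam x0 u"
    by (rule prox_pairE[OF assms(1)])
  have "ereal (p + w \<bullet> (u - x)) \<le> prox_reg h lam x0 u" for u
    by (rule order_trans[OF _ p(2)[rule_format]]) (use assms(2) in simp)
  then show ?thesis by (simp add: subdiff_def p(1))
qed

lemma conjugate_prox_reg: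
  assumes "prox_pair h lam x0 w x" "lam > 0" "prox_reg h lam x0 x = ereal p"
  shows "conjugate (prox_reg h lam x0) w = ereal (w \<bullet> x - p)"
  by (rule conjugate_at_subgradient[OF prox_pair_subgradient[OF assms(1,2)] assms(3)])

text \<open>
  The upper bound is the descent inequality of a \<open>\<lambda>\<close>-smooth function. It evaluates the conjugate
  at \<open>w'\<close> through its own prox point \<open>x'\<close>, uses the growth of \<open>h\<^sup>\<lambda>\<close> from \<open>x\<close> to \<open>x'\<close>, and splits
  \<open>\<langle>w' - w, x' - x\<rangle>\<close> by Young's inequality with weight \<open>\<lambda>\<close>.
\<close>

lemma conjugate_prox_reg_bounds:
  fixes h :: "'a::euclidean_space \<Rightarrow> ereal"
  assumes h: "proper_lsc_convex h" and lam: "lam > 0"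
    and x: "prox_pair h lam x0 w x" and G: "conjugate (prox_reg h lam x0) w = ereal G"
  shows "ereal (G + (w' - w) \<bullet> x) \<le> conjugate (prox_reg h lam x0) w'"
    and "conjugate (prox_reg h lam x0) w' \<le> ereal (G + (w' - w) \<bullet> x + lam / 2 * (norm (w' - w))\<^sup>2)"
proof -
  obtain x' where x': "prox_pair h lam x0 w' x'" using prox_pair_exists[OF h lam] by blast
  obtain p where p: "prox_reg h lam x0 x = ereal p"
    "\<forall>u. ereal (p + w \<bullet> (u - x) + 1 / (2 * lam) * (norm (u - x))\<^sup>2) \<le> prox_reg h lam x0 u"
    by (rule prox_pairE[OF x])
  obtain p' where p': "prox_reg h lam x0 x' = ereal p'" by (rule prox_pairE[OF x'])
  have Gw: "G = w \<bullet> x - p" using conjugate_prox_reg[OF x lam p(1)] G by simp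
  show "ereal (G + (w' - w) \<bullet> x) \<le> conjugate (prox_reg h lam x0) w'"
    using fenchel_young[of w' x "prox_reg h lam x0"] p(1) by (simp add: Gw inner_diff_left)
  have growth: "p + w \<bullet> (x' - x) + 1 / (2 * lam) * (norm (x' - x))\<^sup>2 \<le> p'" using p(2)[rule_format, of x'] p' by simp
  have "(w' - w) \<bullet> (x' - x) \<le> 1 / (2 * lam) * (norm (x' - x))\<^sup>2 + lam / 2 * (norm (w' - w))\<^sup>2"
  proof -
    have "0 \<le> 1 / (2 * lam) * (norm (x' - x - lam *\<^sub>R (w' - w)))\<^sup>2" using lam by simp
    also have "\<dots> = 1 / (2 * lam) * (norm (x' - x))\<^sup>2 - (w' - w) \<bullet> (x' - x) + lam / 2 * (norm (w' - w))\<^sup>2"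
      using lam unfolding power2_norm_eq_inner
      by (simp add: inner_diff_left inner_diff_right inner_left_distrib inner_right_distrib
          inner_commute field_simps)
    finally show ?thesis by simp
  qed
  with growth have "w' \<bullet> x' - p' \<le> G + (w' - w) \<bullet> x + lam / 2 * (norm (w' - w))\<^sup>2"
    by (simp add: Gw inner_diff_left inner_diff_right)
  then show "conjugate (prox_reg h lam x0) w' \<le> ereal (G + (w' - w) \<bullet> x + lam / 2 * (norm (w' - w))\<^sup>2)"
    using conjugate_prox_reg[OF x' lam p'] by simp
qed

text \<open>
  The conjugate lies between its affine minorant with slope \<open>x\<close> and that minorant plus
  \<open>\<lambda>/2 \<parallel>v - w\<parallel>\<^sup>2\<close>; this sandwich forces differentiability with gradient \<open>x\<close>.
\<close>

lemma grad_conjugate_prox_reg: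
  fixes h :: "'a::euclidean_space \<Rightarrow> ereal"
  assumes h: "proper_lsc_convex h" and lam: "lam > 0" and x: "prox_pair h lam x0 w x"
  shows "grad (conjugate (prox_reg h lam x0)) w = x"
proof -
  let ?G = "conjugate (prox_reg h lam x0)" and ?g = "\<lambda>w. real_of_ereal (conjugate (prox_reg h lam x0) w)"
  have fin: "\<bar>?G v\<bar> \<noteq> \<infinity>" for v
  proof -
    obtain y where y: "prox_pair h lam x0 v y" using prox_pair_exists[OF h lam] by blast
    obtain p where "prox_reg h lam x0 y = ereal p" by (rule prox_pairE[OF y])
    from conjugate_prox_reg[OF y lam this] show ?thesis by simp
  qed
  then have Gg: "?G v = ereal (?g v)" for v by (simp add: ereal_real)
  have lower: "?g w + (v - w) \<bullet> x \<le> ?g v" for v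
    using conjugate_prox_reg_bounds(1)[OF h lam x Gg, of v] Gg[of v] by (metis ereal_less_eq(3))
  have upper: "?g v \<le> ?g w + (v - w) \<bullet> x + lam / 2 * (norm (v - w))\<^sup>2" for v
    using conjugate_prox_reg_bounds(2)[OF h lam x Gg, of v] Gg[of v] by (metis ereal_less_eq(3))
  have der: "GDERIV ?g w :> x"
    unfolding gderiv_def
  proof (rule has_derivativeI_sandwich[where e = 1 and H = "\<lambda>v. lam / 2 * norm (v - w)"])
    show "norm (?g v - ?g w - (v - w) \<bullet> x) / norm (v - w) \<le> lam / 2 * norm (v - w)" if "v \<noteq> w" for v
      using lower[of v] upper[of v] that by (simp add: divide_le_eq power2_eq_square mult.assoc)
    have "((\<lambda>v. lam / 2 * norm (v - w)) \<longlongrightarrow> lam / 2 * norm (w - w)) (at w)"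
      by (intro tendsto_intros)
    then show "((\<lambda>v. lam / 2 * norm (v - w)) \<longlongrightarrow> 0) (at w)" by simp
  qed (auto intro: bounded_linear_inner_left)
  show ?thesis
    unfolding grad_def
  proof (rule the_equality)
    show "(\<forall>\<^sub>F v in nhds w. \<bar>?G v\<bar> \<noteq> \<infinity>) \<and> GDERIV ?g w :> x" using fin der by simp
  next
    fix y assume "(\<forall>\<^sub>F v in nhds w. \<bar>?G v\<bar> \<noteq> \<infinity>) \<and> GDERIV ?g w :> y"
    then have "(\<lambda>d. d \<bullet> y) = (\<lambda>d. d \<bullet> x)"
      using der has_derivative_unique unfolding gderiv_def by blast
    then have "(y - x) \<bullet> y = (y - x) \<bullet> x" by (rule fun_cong)
    then have "(y - x) \<bullet> (y - x) = 0" by (simp add: inner_diff_right)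
    then show "y = x" by simp
  qed
qed

lemma prox_pair_grad:
  fixes h :: "'a::euclidean_space \<Rightarrow> ereal"
  assumes "proper_lsc_convex h" "lam > 0"
  shows "prox_pair h lam x0 w (grad (conjugate (prox_reg h lam x0)) w)"
  using prox_pair_exists[OF assms, of x0 w] grad_conjugate_prox_reg[OF assms, of x0 w] by auto

section \<open>One step of the conditional gradient method\<close>

text \<open>
  The supremum over \<open>z\<close> of \<open>\<langle>x, z\<rangle> - f\<^sup>*(z)\<close> is \<open>f(x)\<close>: the Fenchel-Young inequality bounds it, and the
  subgradient \<open>v\<close> attains it. Together with \<open>dual_obj_at_prox_pair\<close> this identifies the Wolfe gap with
  \<open>\<phi>\<^sup>\<lambda>(x) + \<psi>(w)\<close>.
\<close>

lemma wolfe_gap_eq: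
  fixes f h :: "'a::euclidean_space \<Rightarrow> ereal"
  assumes h: "proper_lsc_convex h" and lam: "lam > 0"
    and x: "prox_pair h lam x0 (- w) x" and v: "v \<in> subdiff f x"
    and fx: "f x = ereal fx" and a: "conjugate f w = ereal a"
  shows "wolfe_gap f h lam x0 w = ereal (fx + a - w \<bullet> x)"
  unfolding wolfe_gap_def grad_conjugate_prox_reg[OF h lam x] a
proof (rule antisym)
  show "(SUP z. ereal (- (x \<bullet> (w - z))) + ereal a - conjugate f z) \<le> ereal (fx + a - w \<bullet> x)"
  proof (rule SUP_least)
    fix z
    show "ereal (- (x \<bullet> (w - z))) + ereal a - conjugate f z \<le> ereal (fx + a - w \<bullet> x)"
      using fenchel_young[of z x f] fx
      by (cases "conjugate f z") (auto simp: inner_diff_right inner_commute)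
  qed
  have "ereal (fx + a - w \<bullet> x) = ereal (- (x \<bullet> (w - v))) + ereal a - conjugate f v"
    by (simp add: conjugate_at_subgradient[OF v fx] inner_diff_right inner_commute)
  also have "\<dots> \<le> (SUP z. ereal (- (x \<bullet> (w - z))) + ereal a - conjugate f z)"
    by (rule SUP_upper) simp
  finally show "ereal (fx + a - w \<bullet> x) \<le> \<dots>" .
qed

lemma dual_obj_at_prox_pair:
  assumes "prox_pair h lam x0 (- w) x" "lam > 0" "prox_reg h lam x0 x = ereal p"
    and "conjugate f w = ereal a"
  shows "dual_obj f h lam x0 w = ereal (a - w \<bullet> x - p)"
  using conjugate_prox_reg[OF assms(1-3)] assms(4) by (simp add: dual_obj_def)

text \<open>
  The two parts of \<open>\<psi>\<close> are treated separately: \<open>(h\<^sup>\<lambda>)\<^sup>*\<close> by its smoothness and \<open>f\<^sup>*\<close> by its convexity.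
  The coefficient of \<open>c\<close> that results is the Wolfe gap at \<open>w\<close>.
\<close>

lemma dual_obj_quadratic_model:
  fixes f h :: "'a::euclidean_space \<Rightarrow> ereal"
  assumes f: "\<And>u. f u \<noteq> -\<infinity>" and h: "proper_lsc_convex h" and lam: "lam > 0"
    and x: "prox_pair h lam x0 (- w) x" and v: "v \<in> subdiff f x"
    and fx: "f x = ereal fx" and a: "conjugate f w = ereal a"
    and D: "dual_obj f h lam x0 w = ereal D" and c: "0 \<le> c" "c \<le> 1"
  shows "dual_obj f h lam x0 ((1 - c) *\<^sub>R w + c *\<^sub>R v)
       \<le> ereal (D - c * (fx + a - w \<bullet> x) + c\<^sup>2 * (lam / 2 * (norm (w - v))\<^sup>2))"
proof -
  let ?w = "(1 - c) *\<^sub>R w + c *\<^sub>R v"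
  obtain p where p: "prox_reg h lam x0 x = ereal p" by (rule prox_pairE[OF x])
  have diff: "- ?w - - w = c *\<^sub>R (w - v)" by (simp add: algebra_simps)
  have "conjugate (prox_reg h lam x0) (- ?w)
      \<le> ereal ((- w) \<bullet> x - p + (- ?w - - w) \<bullet> x + lam / 2 * (norm (- ?w - - w))\<^sup>2)"
    by (rule conjugate_prox_reg_bounds(2)[OF h lam x conjugate_prox_reg[OF x lam p]])
  then have G: "conjugate (prox_reg h lam x0) (- ?w)
      \<le> ereal (- (w \<bullet> x) - p + c * ((w - v) \<bullet> x) + c\<^sup>2 * (lam / 2 * (norm (w - v))\<^sup>2))"
    unfolding diff by (simp add: power_mult_distrib mult_ac)
  have "conjugate f ?w \<le> ereal (1 - c) * conjugate f w + ereal c * conjugate f v"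
    using convex_fun_conjugate[of f] f c unfolding convex_fun_def by blast
  then have F: "conjugate f ?w \<le> ereal ((1 - c) * a + c * (v \<bullet> x - fx))"
    by (simp add: a conjugate_at_subgradient[OF v fx])
  have "D = a - w \<bullet> x - p" using dual_obj_at_prox_pair[OF x lam p a] D by simp
  then have "(- (w \<bullet> x) - p + c * ((w - v) \<bullet> x) + c\<^sup>2 * (lam / 2 * (norm (w - v))\<^sup>2))
        + ((1 - c) * a + c * (v \<bullet> x - fx))
      = D - c * (fx + a - w \<bullet> x) + c\<^sup>2 * (lam / 2 * (norm (w - v))\<^sup>2)"
    by (simp add: inner_diff_left algebra_simps)
  then show ?thesis
    using add_mono[OF G F] unfolding dual_obj_def by (simp only: plus_ereal.simps(1))
qed

text \<open>
  The step \<open>min 1 (S / q)\<close> is \<open>1 - \<alpha>\<^sub>j\<close> for the Wolfe gap \<open>S\<close> and \<open>q = \<lambda> \<parallel>z\<^sub>j - \<zeta>\<^sub>j\<parallel>\<^sup>2\<close>, where \<open>\<zeta>\<^sub>j = f'(x\<^sub>j)\<close>: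
  the vertex \<open>S / q\<close> of the parabola, truncated to the unit interval.
\<close>

lemma quadratic_model_minimizer:
  fixes S q c :: real
  assumes "0 < q" "0 \<le> c" "c \<le> 1"
  shows "- (min 1 (S / q) * S) + (min 1 (S / q))\<^sup>2 * (q / 2) \<le> - (c * S) + c\<^sup>2 * (q / 2)"
proof (cases "S \<le> q")
  case True
  then have m: "min 1 (S / q) = S / q" using assms by (simp add: min_def divide_le_eq)
  have "0 \<le> (c - S / q)\<^sup>2 * (q / 2)" using assms by simp
  also have "\<dots> = (- (c * S) + c\<^sup>2 * (q / 2)) - (- (S / q * S) + (S / q)\<^sup>2 * (q / 2))"
    using assms by (simp add: power2_eq_square field_simps)
  finally show ?thesis unfolding m by simp
next
  case False
  then have m: "min 1 (S / q) = 1" using assms by (simp add: min_def le_divide_eq)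
  have "(1 - c) * ((1 + c) / 2 * q) \<le> (1 - c) * S"
  proof (rule mult_left_mono)
    have "(1 + c) / 2 * q \<le> 1 * q" using assms by (intro mult_right_mono) auto
    with False show "(1 + c) / 2 * q \<le> S" by simp
  qed (use assms in simp)
  then show ?thesis unfolding m by (simp add: power2_eq_square field_simps)
qed

text \<open>
  This is what makes the two weight rules interchangeable: \<open>\<beta>\<close> minimizes \<open>\<psi>\<close> on the segment and
  \<open>\<alpha>\<close> minimizes its quadratic upper model, so under either rule the next dual value is below the
  model at every \<open>c\<close>. If \<open>w = v\<close>, the Wolfe gap vanishes and so does the quadratic term, which leaves
  \<open>\<psi>(w) \<le> \<psi>(w)\<close>.
\<close>

lemma cg_weight_model_optimal:
  fixes f h :: "'a::euclidean_space \<Rightarrow> ereal"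
  assumes f: "\<And>u. f u \<noteq> -\<infinity>" and h: "proper_lsc_convex h" and lam: "lam > 0"
    and x: "prox_pair h lam x0 (- w) x" and v: "v \<in> subdiff f x"
    and fx: "f x = ereal fx" and a: "conjugate f w = ereal a"
    and D: "dual_obj f h lam x0 w = ereal D"
    and weight: "alpha_weight f h lam x0 w v b \<or> beta_weight f h lam x0 w v b"
  shows "b \<in> {0..1}"
    and "\<And>c. 0 \<le> c \<Longrightarrow> c \<le> 1 \<Longrightarrow> dual_obj f h lam x0 (b *\<^sub>R w + (1 - b) *\<^sub>R v)
       \<le> ereal (D - c * (fx + a - w \<bullet> x) + c\<^sup>2 * (lam / 2 * (norm (w - v))\<^sup>2))"
proof -
  define S q where "S = fx + a - w \<bullet> x" and "q = lam * (norm (w - v))\<^sup>2"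
  note model = dual_obj_quadratic_model[OF f h lam x v fx a D, folded S_def]
  have "b \<in> {0..1} \<and> (\<forall>c. 0 \<le> c \<and> c \<le> 1 \<longrightarrow> dual_obj f h lam x0 (b *\<^sub>R w + (1 - b) *\<^sub>R v)
       \<le> ereal (D - c * S + c\<^sup>2 * (q / 2)))" (is "_ \<and> ?opt")
    using weight
  proof
    assume beta: "beta_weight f h lam x0 w v b"
    then have b: "b \<in> {0..1}"
      and le: "\<And>c. c \<in> {0..1} \<Longrightarrow> dual_obj f h lam x0 (b *\<^sub>R w + (1 - b) *\<^sub>R v)
        \<le> dual_obj f h lam x0 (c *\<^sub>R w + (1 - c) *\<^sub>R v)"
      unfolding beta_weight_def Argmin_def is_arg_min_linorder by auto
    show ?thesis
    proof (intro conjI allI impI)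
      fix c :: real assume c: "0 \<le> c \<and> c \<le> 1"
      show "dual_obj f h lam x0 (b *\<^sub>R w + (1 - b) *\<^sub>R v) \<le> ereal (D - c * S + c\<^sup>2 * (q / 2))"
        using le[of "1 - c"] model[of c] c by (simp add: q_def)
    qed (rule b)
  next
    assume alpha: "alpha_weight f h lam x0 w v b"
    show ?thesis
    proof (cases "w = v")
      case True
      then have "b *\<^sub>R w + (1 - b) *\<^sub>R v = w" by (simp add: algebra_simps)
      moreover have "S = 0"
        using a conjugate_at_subgradient[OF v fx] True by (simp add: S_def)
      ultimately show ?thesis using alpha True D by (simp add: alpha_weight_def q_def)
    next
      case False
      then have q: "q > 0" using lam by (simp add: q_def)
      have "ereal (w \<bullet> x) - f x \<le> ereal a" using fenchel_young[of w x f] a by simp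
      then have S: "S \<ge> 0" by (simp add: S_def fx)
      have "ereal b = max 0 (1 - ereal S / ereal q)"
        using alpha False wolfe_gap_eq[OF h lam x v fx a]
        by (simp add: alpha_weight_def S_def q_def)
      also have "\<dots> = ereal (max 0 (1 - S / q))"
        using q by (simp add: zero_ereal_def one_ereal_def max_def)
      finally have b: "1 - b = min 1 (S / q)" by (simp add: max_def min_def)
      have "0 \<le> 1 - b" "1 - b \<le> 1" unfolding b using S q by simp_all
      then have b01: "b \<in> {0..1}" by simp
      have "dual_obj f h lam x0 (b *\<^sub>R w + (1 - b) *\<^sub>R v) \<le> ereal (D - (1 - b) * S + (1 - b)\<^sup>2 * (q / 2))"
        using model[of "1 - b"] b01 by (simp add: q_def)
      moreover have "D - (1 - b) * S + (1 - b)\<^sup>2 * (q / 2) \<le> D - c * S + c\<^sup>2 * (q / 2)"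
        if "0 \<le> c" "c \<le> 1" for c
        using quadratic_model_minimizer[OF q that, of S] unfolding b by simp
      ultimately show ?thesis using b01 by (meson ereal_less_eq(3) order_trans)
    qed
  qed
  then show "b \<in> {0..1}" and "\<And>c. 0 \<le> c \<Longrightarrow> c \<le> 1 \<Longrightarrow> dual_obj f h lam x0 (b *\<^sub>R w + (1 - b) *\<^sub>R v)
       \<le> ereal (D - c * (fx + a - w \<bullet> x) + c\<^sup>2 * (lam / 2 * (norm (w - v))\<^sup>2))"
    by (auto simp: S_def q_def)
qed

section \<open>The gap recursion\<close>

text \<open>
  After multiplication by \<open>(j+1)(j+2)\<close> the recursion says that \<open>j (j+1) g\<^sub>j\<close> grows by at most
  \<open>4 C (j+1)/(j+2) \<le> 4 C\<close> per step.
\<close>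

lemma gap_recursion_bound:
  fixes g :: "nat \<Rightarrow> real"
  assumes C: "C \<ge> 0"
    and step: "\<And>j. j \<ge> 1 \<Longrightarrow> g (Suc j) \<le> real j / (real j + 2) * g j + (2 / (real j + 2))\<^sup>2 * C"
    and j: "j \<ge> 1"
  shows "g j \<le> 2 * g 1 / (real j * (real j + 1)) + 4 * C / (real j + 1)"
proof -
  have "real j * (real j + 1) * g j \<le> 2 * g 1 + 4 * C * (real j - 1)"
    using j
  proof (induction j rule: dec_induct)
    case base
    then show ?case by simp
  next
    case (step j)
    have "(real j + 1) * (real j + 2) * g (Suc j)
        \<le> (real j + 1) * (real j + 2) * (real j / (real j + 2) * g j + (2 / (real j + 2))\<^sup>2 * C)"
      using assms(2)[OF step(1)] by (intro mult_left_mono) auto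
    also have "\<dots> = real j * (real j + 1) * g j + 4 * C * ((real j + 1) / (real j + 2))"
    proof -
      have *: "(m - 1) * m * ((m - 2) / m * b + (2 / m)\<^sup>2 * C) = (m - 2) * (m - 1) * b + 4 * C * ((m - 1) / m)"
        if "m > 0" for m b :: real
        using that by (simp add: power2_eq_square field_simps)
      show ?thesis using *[of "real j + 2" "g j"] by (simp add: ac_simps)
    qed
    also have "\<dots> \<le> (2 * g 1 + 4 * C * (real j - 1)) + 4 * C * 1"
      using C by (intro add_mono step.IH mult_left_mono) auto
    finally show ?case by (simp add: algebra_simps)
  qed
  also have "\<dots> \<le> 2 * g 1 + 4 * C * real j" using C by (simp add: algebra_simps)
  finally have "g j \<le> (2 * g 1 + 4 * C * real j) / (real j * (real j + 1))"
    using j by (simp add: le_divide_eq mult.commute)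
  also have "\<dots> = 2 * g 1 / (real j * (real j + 1)) + 4 * C / (real j + 1)"
    using j by (simp add: add_divide_distrib)
  finally show ?thesis .
qed

section \<open>Distance of the prox centers to a minimizer\<close>

text \<open>
  The initial linearization has these properties by the subgradient inequality, and every later
  model has them by the update condition.
\<close>

lemma pdcp_model_minorizes:
  fixes f h :: "'a::euclidean_space \<Rightarrow> ereal"
  assumes f0: "f x0 = ereal f0" and sub: "f' x0 \<in> subdiff f x0"
    and init: "\<Gamma> 1 = linz f f' x0"
    and upd: "\<And>j. j \<in> {1..<J} \<Longrightarrow> pdcp_model_update f g f' (x j) (\<tau> j) (\<Gamma> j) (\<Gamma> (Suc j))"
    and J: "J \<ge> 1"
  shows "convex_fun (\<Gamma> J)" "\<And>u. \<Gamma> J u \<noteq> -\<infinity>" "\<And>u. \<Gamma> J u \<le> f u"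
proof -
  have "convex_fun (\<Gamma> J) \<and> (\<forall>u. \<Gamma> J u \<noteq> -\<infinity>) \<and> (\<forall>u. \<Gamma> J u \<le> f u)"
  proof (cases "J = 1")
    case True
    have "convex_fun (linz f f' x0)"
      by (simp add: convex_fun_def linz_def f0 inner_diff_right inner_add_right algebra_simps)
    moreover have "\<forall>u. linz f f' x0 u \<le> f u" using sub by (simp add: linz_def subdiff_def)
    ultimately show ?thesis using True init by (simp add: linz_def f0)
  next
    case False
    then obtain i where i: "J = Suc i" "i \<in> {1..<J}" using J by (cases J) auto
    from upd[OF i(2)] show ?thesis
      unfolding i(1) pdcp_model_update_def proper_lsc_convex_def proper_fun_def by blast
  qed
  then show "convex_fun (\<Gamma> J)" "\<And>u. \<Gamma> J u \<noteq> -\<infinity>" "\<And>u. \<Gamma> J u \<le> f u" by auto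
qed

lemma Argmin_composite_finite:
  assumes f: "proper_lsc_convex f" and h: "proper_lsc_convex h" and dom: "eff_dom h \<subseteq> eff_dom f"
    and y: "y \<in> Argmin (\<lambda>u. f u + h u) UNIV"
  obtains fy hy where "f y = ereal fy" "h y = ereal hy" "\<And>u. ereal (fy + hy) \<le> f u + h u"
proof -
  have fin: "\<And>u. f u \<noteq> -\<infinity>" "\<And>u. h u \<noteq> -\<infinity>" "eff_dom h \<noteq> {}"
    using f h by (auto simp: proper_lsc_convex_def proper_fun_def)
  then obtain p where "h p < \<infinity>" "f p < \<infinity>" using dom by (auto simp: eff_dom_def)
  moreover have min: "f y + h y \<le> f u + h u" for u
    using y by (simp add: Argmin_def is_arg_min_linorder)
  ultimately have "f y + h y < \<infinity>" using min[of p] by (cases "f p"; cases "h p") auto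
  then obtain fy hy where "f y = ereal fy" "h y = ereal hy"
    using fin(1,2)[of y] by (cases "f y"; cases "h y") auto
  with min show thesis by (intro that) auto
qed

text \<open>
  The last model is below \<open>f\<close>, so quadratic growth at its prox point \<open>xo\<close> gives
  \<open>m + \<parallel>y - xo\<parallel>\<^sup>2/(2\<lambda>) \<le> \<phi>(y) + \<parallel>y - x0\<parallel>\<^sup>2/(2\<lambda>)\<close> for the minimum value \<open>m\<close> of the last prox subproblem. The stopping test
  and minimality of \<open>y\<close> give \<open>\<phi>(y) \<le> m + \<epsilon>\<close>.
\<close>

lemma pdcp_returns_fejer:
  fixes f h :: "'a::euclidean_space \<Rightarrow> ereal"
  assumes f: "proper_lsc_convex f" and h: "proper_lsc_convex h" and dom: "eff_dom h \<subseteq> eff_dom f"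
    and sub: "f' x0 \<in> subdiff f x0" and lam: "lam > 0" and x0: "x0 \<in> eff_dom h"
    and run: "pdcp_returns f h f' x0 lam eps xo xto so"
    and y: "y \<in> Argmin (\<lambda>u. f u + h u) UNIV"
  shows "xo \<in> eff_dom h" "(norm (y - xo))\<^sup>2 \<le> (norm (y - x0))\<^sup>2 + 2 * lam * eps"
proof -
  have fin: "\<And>u. f u \<noteq> -\<infinity>" "\<And>u. h u \<noteq> -\<infinity>" and cvx: "convex_fun h"
    using f h by (auto simp: proper_lsc_convex_def proper_fun_def)
  obtain f0 h0 where f0: "f x0 = ereal f0" and h0: "h x0 = ereal h0"
  proof -
    have "x0 \<in> eff_dom f" using x0 dom by blast
    then show thesis
      using x0 fin[of x0] that by (cases "f x0"; cases "h x0") (auto simp: eff_dom_def)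
  qed
  obtain fy hy where fy: "f y = ereal fy" and hy: "h y = ereal hy"
    and ymin: "\<And>u. ereal (fy + hy) \<le> f u + h u"
    using Argmin_composite_finite[OF f h dom y] by blast
  obtain \<Gamma> x xt \<tau> t J where J: "J \<ge> 1" and init: "\<Gamma> 1 = linz f f' x0"
    and arg: "Argmin (\<lambda>u. \<Gamma> J u + prox_reg h lam x0 u) UNIV = {x J}"
    and t: "t J = prox_obj f h lam x0 (xt J) - (\<Gamma> J (x J) + prox_reg h lam x0 (x J))"
    and upd: "\<And>j. j \<in> {1..<J} \<Longrightarrow>
      pdcp_model_update f (prox_reg h lam x0) f' (x j) (\<tau> j) (\<Gamma> j) (\<Gamma> (Suc j))"
    and stop: "t J \<le> ereal eps" and xo: "xo = x J"
  proof -
    from run obtain \<Gamma> x xt s \<tau> t J where *: "J \<ge> 1" "\<Gamma> 1 = linz f f' x0"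
      "\<forall>j\<in>{1..J}. Argmin (\<lambda>u. \<Gamma> j u + prox_reg h lam x0 u) UNIV = {x j}"
      "\<forall>j\<in>{1..J}. t j = prox_obj f h lam x0 (xt j) - (\<Gamma> j (x j) + prox_reg h lam x0 (x j))"
      "\<forall>j\<in>{1..<J}. \<tau> j \<in> {0..1} \<and>
         pdcp_model_update f (prox_reg h lam x0) f' (x j) (\<tau> j) (\<Gamma> j) (\<Gamma> (Suc j))"
      "t J \<le> ereal eps" "xo = x J"
      unfolding pdcp_returns_def by (elim exE conjE) (rule that)
    show thesis
      by (rule that[of J \<Gamma> x t xt \<tau>]) (use * in auto)
  qed
  note \<Gamma> = pdcp_model_minorizes[OF f0 sub init upd J]
  define c where "c = 1 / (2 * lam)"
  have c: "c > 0" using lam by (simp add: c_def)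
  have xo_min: "\<Gamma> J xo + h xo + ereal (c * (norm (xo - x0))\<^sup>2) \<le> \<Gamma> J u + h u + ereal (c * (norm (u - x0))\<^sup>2)"
    for u
  proof -
    have "xo \<in> Argmin (\<lambda>u. \<Gamma> J u + prox_reg h lam x0 u) UNIV" using arg xo by simp
    then show ?thesis
      unfolding Argmin_def is_arg_min_linorder by (simp add: prox_reg_def c_def add.assoc)
  qed
  have "\<Gamma> J xo + h xo + ereal (c * (norm (xo - x0))\<^sup>2) \<le> \<Gamma> J x0 + h x0" using xo_min[of x0] by simp
  also have "\<dots> \<le> ereal (f0 + h0)" using \<Gamma>(3)[of x0] by (simp add: f0 h0 flip: plus_ereal.simps(1)) (intro add_right_mono)
  finally obtain gx hx where gx: "\<Gamma> J xo = ereal gx" and hx: "h xo = ereal hx"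
    using \<Gamma>(2)[of xo] fin(2)[of xo] by (cases "\<Gamma> J xo"; cases "h xo") auto
  show "xo \<in> eff_dom h" by (simp add: eff_dom_def hx)
  have "\<Gamma> J xo + h xo + ereal (c * (norm (xo - x0))\<^sup>2 + c * (norm (y - xo))\<^sup>2)
      \<le> \<Gamma> J y + h y + ereal (c * (norm (y - x0))\<^sup>2)"
    by (rule prox_minimizer_growth[OF convex_fun_add[OF \<Gamma>(1) cvx]])
      (use \<Gamma>(2) fin(2) xo_min in \<open>auto simp: gx hx\<close>)
  also have "\<dots> \<le> f y + h y + ereal (c * (norm (y - x0))\<^sup>2)" by (intro add_right_mono \<Gamma>(3))
  finally have growth: "gx + hx + c * (norm (xo - x0))\<^sup>2 + c * (norm (y - xo))\<^sup>2
      \<le> fy + hy + c * (norm (y - x0))\<^sup>2" by (simp add: gx hx fy hy)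
  have "prox_obj f h lam x0 (xt J) - ereal (gx + hx + c * (norm (xo - x0))\<^sup>2) \<le> ereal eps"
    using stop unfolding t xo[symmetric] by (simp add: gx hx prox_reg_def c_def add.assoc)
  then have "prox_obj f h lam x0 (xt J) \<le> ereal (eps + gx + hx + c * (norm (xo - x0))\<^sup>2)"
    by (cases "prox_obj f h lam x0 (xt J)") auto
  moreover have "f (xt J) + h (xt J) \<le> prox_obj f h lam x0 (xt J)"
    using lam by (cases "f (xt J)"; cases "h (xt J)") (auto simp: prox_obj_def prox_reg_def)
  ultimately have "ereal (fy + hy) \<le> ereal (eps + gx + hx + c * (norm (xo - x0))\<^sup>2)"
    using ymin[of "xt J"] by (meson order_trans)
  with growth have "c * (norm (y - xo))\<^sup>2 \<le> c * (norm (y - x0))\<^sup>2 + eps" by simp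
  then show "(norm (y - xo))\<^sup>2 \<le> (norm (y - x0))\<^sup>2 + 2 * lam * eps"
    using lam by (simp add: c_def field_simps)
qed

lemma pdpb_run_fejer:
  fixes f h :: "'a::euclidean_space \<Rightarrow> ereal"
  assumes f: "proper_lsc_convex f" and h: "proper_lsc_convex h" and dom: "eff_dom h \<subseteq> eff_dom f"
    and sub: "\<And>p. p \<in> eff_dom h \<Longrightarrow> f' p \<in> subdiff f p" and lam: "lam > 0"
    and x0: "xhat0 \<in> eff_dom h" and run: "pdpb_run f h f' xhat0 lam eps K xh xt s"
    and y: "y \<in> Argmin (\<lambda>u. f u + h u) UNIV" and i: "i \<le> K"
  shows "xh i \<in> eff_dom h \<and> (norm (y - xh i))\<^sup>2 \<le> (norm (y - xhat0))\<^sup>2 + 2 * lam * eps * real i"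
  using i
proof (induction i)
  case 0
  then show ?case using run x0 by (simp add: pdpb_run_def)
next
  case (Suc i)
  then have IH: "xh i \<in> eff_dom h" "(norm (y - xh i))\<^sup>2 \<le> (norm (y - xhat0))\<^sup>2 + 2 * lam * eps * real i"
    by auto
  have "\<forall>i\<in>{1..K}. pdcp_returns f h f' (xh (i - 1)) lam eps (xh i) (xt i) (s i)"
    using run by (simp add: pdpb_run_def)
  from bspec[OF this, of "Suc i"] Suc.prems
  have "pdcp_returns f h f' (xh i) lam eps (xh (Suc i)) (xt (Suc i)) (s (Suc i))" by simp
  from pdcp_returns_fejer[OF f h dom sub[OF IH(1)] lam IH(1) this y] IH(2)
  show ?case by (simp add: algebra_simps)
qed

section \<open>The first gap\<close>

text \<open>
  The left-hand side, the linearization error of \<open>f\<close>, is at most \<open>2 M r\<close> for \<open>r = \<parallel>x1 - x0\<parallel>\<close>, since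
  the subgradients \<open>v0\<close> and \<open>v1\<close> differ by at most \<open>2 M\<close>. The growth of the prox subproblem at \<open>x1\<close>,
  tested at the minimizer \<open>y\<close>, gives \<open>r\<^sup>2 + \<parallel>y - x1\<parallel>\<^sup>2 \<le> \<parallel>y - x0\<parallel>\<^sup>2 + 4 \<lambda> M r\<close>; with the triangle
  inequality for \<open>\<parallel>y - x1\<parallel>\<close> this bounds \<open>r\<close>.
\<close>

lemma first_gap_bound:
  fixes f h :: "'a::euclidean_space \<Rightarrow> ereal"
  assumes lam: "lam > 0" and x1: "prox_pair h lam x0 (- v0) x1"
    and v0: "v0 \<in> subdiff f x0" "norm v0 \<le> M" and v1: "v1 \<in> subdiff f x1" "norm v1 \<le> M"
    and f0: "f x0 = ereal f0" and f1: "f x1 = ereal f1"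
    and fy: "f y = ereal fy" and hy: "h y = ereal hy" and ymin: "ereal (fy + hy) \<le> f x1 + h x1"
  shows "f1 - f0 - v0 \<bullet> (x1 - x0) \<le> 2 * M * (norm (y - x0) + 2 * lam * M)"
proof -
  define r d e where "r = norm (x1 - x0)" and "d = norm (y - x0)" and "e = norm (y - x1)"
  from x1 obtain h1 where h1: "h x1 = ereal h1" unfolding prox_pair_def by (cases "h x1") auto
  have M: "M \<ge> 0" using v0(2) norm_ge_zero[of v0] by linarith
  have "prox_reg h lam x0 x1 + ereal (- v0 \<bullet> (y - x1) + 1 / (2 * lam) * (norm (y - x1))\<^sup>2)
      \<le> prox_reg h lam x0 y" using x1 unfolding prox_pair_def by blast
  then have growth: "h1 + 1 / (2 * lam) * r\<^sup>2 - v0 \<bullet> (y - x1) + 1 / (2 * lam) * e\<^sup>2 \<le> hy + 1 / (2 * lam) * d\<^sup>2"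
    by (simp add: prox_reg_def h1 hy r_def d_def e_def)
  have "f0 + v0 \<bullet> (y - x0) \<le> fy" using v0(1) unfolding subdiff_def by (auto simp: f0 fy dest!: spec[of _ y])
  moreover have "f1 + v1 \<bullet> (x0 - x1) \<le> f0" using v1(1) unfolding subdiff_def by (auto simp: f0 f1 dest!: spec[of _ x0])
  moreover have "fy + hy \<le> f1 + h1" using ymin by (simp add: f1 h1)
  ultimately have gap: "f1 - f0 - v0 \<bullet> (x1 - x0) \<le> (v1 - v0) \<bullet> (x1 - x0)"
    and dist: "1 / (2 * lam) * r\<^sup>2 + 1 / (2 * lam) * e\<^sup>2 \<le> f1 - f0 - v0 \<bullet> (x1 - x0) + 1 / (2 * lam) * d\<^sup>2"
    using growth by (simp_all add: inner_diff_left inner_diff_right)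
  have "(v1 - v0) \<bullet> (x1 - x0) \<le> norm (v1 - v0) * r" unfolding r_def by (rule norm_cauchy_schwarz)
  also have "norm (v1 - v0) * r \<le> 2 * M * r"
    using norm_triangle_ineq4[of v1 v0] v0(2) v1(2) by (intro mult_right_mono) (auto simp: r_def)
  finally have gap_r: "f1 - f0 - v0 \<bullet> (x1 - x0) \<le> 2 * M * r" using gap by simp
  have "r \<le> d + 2 * lam * M"
  proof (rule ccontr)
    assume "\<not> ?thesis"
    then have far: "r > d + 2 * lam * M" by simp
    have lM: "lam * M \<ge> 0" using lam M by simp
    have "d \<ge> 0" by (simp add: d_def)
    then have rd: "0 \<le> r - d" "0 < r" using far lM by auto
    have "r - d \<le> e" using norm_triangle_ineq2[of "x1 - x0" "y - x0"]
      by (simp add: r_def d_def e_def norm_minus_commute)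
    then have e: "(r - d)\<^sup>2 \<le> e\<^sup>2" using rd by (intro power_mono)
    have "1 / (2 * lam) * (r\<^sup>2 + e\<^sup>2 - d\<^sup>2) \<le> 2 * M * r"
      using dist gap_r by (simp add: algebra_simps)
    then have "r\<^sup>2 + e\<^sup>2 - d\<^sup>2 \<le> 4 * (lam * M) * r" using lam by (simp add: field_simps)
    with e have "2 * r * r \<le> 2 * r * (d + 2 * (lam * M))" by (simp add: power2_eq_square algebra_simps)
    with rd far show False by simp
  qed
  then have "2 * M * r \<le> 2 * M * (d + 2 * lam * M)" using M by (intro mult_left_mono) auto
  with gap_r show ?thesis by (simp add: d_def)
qed

section \<open>The convergence rate\<close>

theorem theorem3p3:
  fixes f h :: "real ^ 'n \<Rightarrow> ereal"
    and f' :: "real ^ 'n \<Rightarrow> real ^ 'n"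
    and M lam eps d0 :: real
    and xhat0 x0 :: "real ^ 'n"
    and xh xt s z zb x u :: "nat \<Rightarrow> real ^ 'n"
    and \<tau> :: "nat \<Rightarrow> real"
    and k :: nat
  assumes "proper_lsc_convex f" and "proper_lsc_convex h"
    and "eff_dom h \<subseteq> eff_dom f"
    and "\<forall>y\<in>eff_dom h. f' y \<in> subdiff f y"
    and "M > 0" and "\<forall>y\<in>eff_dom h. norm (f' y) \<le> M"
    and "Argmin (\<lambda>y. f y + h y) UNIV \<noteq> {}"
    and "xhat0 \<in> eff_dom h"
    and "d0 = infdist xhat0 (Argmin (\<lambda>y. f y + h y) UNIV)"
    and "lam > 0" and "eps > 0"
    and "k \<ge> 1" and "real k \<le> 2 * d0\<^sup>2 / (lam * eps)"
    and "pdpb_run f h f' xhat0 lam eps (k - 1) xh xt s"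
    and "x0 = xh (k - 1)"
    and "cg_run f h f' lam x0 (f' x0) \<tau> z zb"
    and "(\<forall>j\<ge>1. alpha_weight f h lam x0 (z j) (zb j) (\<tau> j)) \<or>
         (\<forall>j\<ge>1. beta_weight f h lam x0 (z j) (zb j) (\<tau> j))"
    and "\<forall>j\<ge>1. x j = grad (conjugate (prox_reg h lam x0)) (- z j)"
    and "u 1 = x 1"
    and "\<forall>j\<ge>1. u (Suc j) =
           (real j / (real j + 2)) *\<^sub>R u j + (2 / (real j + 2)) *\<^sub>R x j"
  shows "\<forall>j\<ge>1. prox_obj f h lam x0 (u j) + dual_obj f h lam x0 (z j) \<le>
           ereal (8 * M * (3 * d0 + lam * M) / (real j * (real j + 1))
                  + 8 * lam * M\<^sup>2 / (real j + 1))"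
proof -
  note f = assms(1) and h = assms(2) and dom = assms(3) and lam = assms(10)
  let ?X = "Argmin (\<lambda>y. f y + h y) UNIV"
  have fin: "\<And>u. f u \<noteq> -\<infinity>" "\<And>u. h u \<noteq> -\<infinity>" and cvx: "convex_fun f" "convex_fun h"
    using f h by (auto simp: proper_lsc_convex_def proper_fun_def)
  have sub: "f' p \<in> subdiff f p" "norm (f' p) \<le> M" if "p \<in> eff_dom h" for p
    using assms(4,6) that by auto

  have kd: "real k * (lam * eps) \<le> 2 * d0\<^sup>2" using assms(10,11,13) by (simp add: field_simps)
  have le: "lam * eps > 0" using assms(10,11) by simp
  have "1 * (lam * eps) \<le> real k * (lam * eps)" using assms(12) le by (intro mult_right_mono) auto
  with kd le have "d0\<^sup>2 > 0" by linarith
  moreover have "d0 \<ge> 0" using assms(9) infdist_nonneg by simp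
  ultimately have d0: "d0 > 0" by (simp add: zero_less_power2)
  \<comment> \<open>The bound on \<open>k\<close> forces \<open>d0 > 0\<close>, so some minimizer lies at distance below \<open>2 d0\<close>. With an
    increase of the squared distance by at most \<open>4 d0\<^sup>2\<close> this still gives \<open>8 d0\<^sup>2 \<le> (3 d0)\<^sup>2\<close>.\<close>
  obtain y where y: "y \<in> ?X" and yd: "dist xhat0 y < 2 * d0"
  proof -
    have "(INF a\<in>?X. dist xhat0 a) < 2 * d0"
      using d0 assms(7,9) by (simp add: infdist_notempty)
    then show thesis
      using assms(7) that by (subst (asm) cINF_less_iff) (auto intro: bdd_belowI2[of _ 0])
  qed
  have near: "x0 \<in> eff_dom h \<and> (norm (y - x0))\<^sup>2 \<le> (norm (y - xhat0))\<^sup>2 + 2 * lam * eps * real (k - 1)"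
    unfolding assms(15) by (rule pdpb_run_fejer[OF f h dom sub(1) lam assms(8,14) y]) auto
  then have x0: "x0 \<in> eff_dom h" ..
  have yx0: "norm (y - x0) \<le> 3 * d0"
  proof (rule power2_le_imp_le)
    have "(norm (y - xhat0))\<^sup>2 \<le> (2 * d0)\<^sup>2"
      using yd by (intro power_mono) (auto simp: dist_norm norm_minus_commute)
    then have "(norm (y - xhat0))\<^sup>2 \<le> 4 * d0\<^sup>2" by (simp add: power_mult_distrib)
    moreover have "2 * lam * eps * real (k - 1) \<le> 2 * (real k * (lam * eps))"
      using mult_left_mono[of "real (k - 1)" "real k" "2 * (lam * eps)"] le by (simp add: mult_ac)
    ultimately have "(norm (y - x0))\<^sup>2 \<le> 8 * d0\<^sup>2"
      using near[THEN conjunct2] kd by linarith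
    also have "\<dots> \<le> (3 * d0)\<^sup>2" by (simp add: power_mult_distrib)
    finally show "(norm (y - x0))\<^sup>2 \<le> (3 * d0)\<^sup>2" .
  qed (use d0 in simp)

  have pair: "prox_pair h lam x0 (- z j) (x j)" if "j \<ge> 1" for j
    using prox_pair_grad[OF h lam] assms(18) that by simp
  have xdom: "x j \<in> eff_dom h" if "j \<ge> 1" for j
    using pair[OF that] by (auto simp: prox_pair_def eff_dom_def)
  have z1: "z 1 = f' x0" and zb: "\<And>j. j \<ge> 1 \<Longrightarrow> zb j = f' (x j)"
    and zSuc: "\<And>j. j \<ge> 1 \<Longrightarrow> z (Suc j) = \<tau> j *\<^sub>R z j + (1 - \<tau> j) *\<^sub>R zb j"
    using assms(16,18) by (auto simp: cg_run_def)
  have zb_sub: "zb j \<in> subdiff f (x j)" "norm (zb j) \<le> M" if "j \<ge> 1" for j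
    using sub[OF xdom[OF that]] zb[OF that] by auto
  have weight: "alpha_weight f h lam x0 (z j) (zb j) (\<tau> j) \<or> beta_weight f h lam x0 (z j) (zb j) (\<tau> j)"
    if "j \<ge> 1" for j
    using assms(17) that by blast
  have ffin: "f p = ereal (real_of_ereal (f p))" if "p \<in> eff_dom h" for p
  proof -
    have "p \<in> eff_dom f" using dom that by blast
    then show ?thesis using fin(1)[of p] by (cases "f p") (auto simp: eff_dom_def)
  qed
  define F where "F j = real_of_ereal (f (x j))" for j
  define p where "p j = real_of_ereal (prox_reg h lam x0 (x j))" for j
  define a where "a j = real_of_ereal (conjugate f (z j))" for j
  define D where "D j = a j - z j \<bullet> x j - p j" for j
  have F: "f (x j) = ereal (F j)" if "j \<ge> 1" for j
    unfolding F_def by (rule ffin[OF xdom[OF that]])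
  have p: "prox_reg h lam x0 (x j) = ereal (p j)" if "j \<ge> 1" for j
    by (rule prox_pairE[OF pair[OF that]]) (simp add: p_def)
  have dual_if: "dual_obj f h lam x0 (z j) = ereal (D j)" if "j \<ge> 1" "conjugate f (z j) = ereal (a j)" for j
    unfolding D_def by (rule dual_obj_at_prox_pair[OF pair[OF that(1)] lam p[OF that(1)] that(2)])
  \<comment> \<open>Finiteness of the dual value is proved together with the norm bound: the weights are only known
    to lie in \<open>[0,1]\<close> once the dual value at \<open>z j\<close> is finite.\<close>
  have z: "conjugate f (z j) = ereal (a j) \<and> norm (z j) \<le> M" if "j \<ge> 1" for j
    using that
  proof (induction j rule: dec_induct)
    case base
    have "conjugate f (z 1) = ereal (f' x0 \<bullet> x0 - real_of_ereal (f x0))"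
      unfolding z1 by (rule conjugate_at_subgradient[OF sub(1)[OF x0] ffin[OF x0]])
    then show ?case using sub(2)[OF x0] by (simp add: a_def z1 del: One_nat_def)
  next
    case (step j)
    note j = \<open>1 \<le> j\<close>
    have aj: "conjugate f (z j) = ereal (a j)" and Mj: "norm (z j) \<le> M" using step.IH by auto
    have t: "0 \<le> 1 - \<tau> j \<and> 1 - \<tau> j \<le> 1"
      using cg_weight_model_optimal(1)[OF fin(1) h lam pair[OF j] zb_sub(1)[OF j] F[OF j] aj
          dual_if[OF j aj] weight[OF j]] by simp
    have zS: "z (Suc j) = (1 - (1 - \<tau> j)) *\<^sub>R z j + (1 - \<tau> j) *\<^sub>R zb j" using zSuc[OF j] by simp
    have "conjugate f (z (Suc j)) \<le> ereal (1 - (1 - \<tau> j)) * conjugate f (z j) + ereal (1 - \<tau> j) * conjugate f (zb j)"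
      unfolding zS using convex_fun_conjugate[of f] fin(1) t unfolding convex_fun_def by blast
    also have "\<dots> < \<infinity>" by (simp add: aj conjugate_at_subgradient[OF zb_sub(1)[OF j] F[OF j]])
    finally have "conjugate f (z (Suc j)) = ereal (a (Suc j))"
      using conjugate_neq_MInf[of f "x j" "z (Suc j)"] F[OF j]
      unfolding a_def by (cases "conjugate f (z (Suc j))") auto
    moreover have "z (Suc j) \<in> cball 0 M"
      unfolding zS by (rule convexD_alt[OF convex_cball]) (use Mj zb_sub(2)[OF j] t in auto)
    ultimately show ?case by simp
  qed
  have dual: "dual_obj f h lam x0 (z j) = ereal (D j)" if "j \<ge> 1" for j
    using dual_if z that by blast

  define U where "U j = real_of_ereal (prox_obj f h lam x0 (u j))" for j
  have obj_x: "prox_obj f h lam x0 (x j) = ereal (F j + p j)" if "j \<ge> 1" for j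
    using F[OF that] p[OF that] by (simp add: prox_obj_def)
  have obj_ninf: "prox_obj f h lam x0 v \<noteq> -\<infinity>" for v
    using fin[of v] by (cases "f v"; cases "h v") (auto simp: prox_obj_def prox_reg_def)
  have "convex_fun (\<lambda>v. f v + prox_reg h lam x0 v)"
    by (rule convex_fun_add[OF cvx(1) convex_fun_prox_reg[OF cvx(2) lam]])
  then have obj_cvx: "convex_fun (prox_obj f h lam x0)" by (simp add: prox_obj_def[abs_def])
  have obj_step: "prox_obj f h lam x0 (u (Suc j))
      \<le> ereal (1 - 2 / (real j + 2)) * prox_obj f h lam x0 (u j) + ereal (2 / (real j + 2) * (F j + p j))"
    if j: "j \<ge> 1" for j
  proof -
    have "u (Suc j) = (1 - 2 / (real j + 2)) *\<^sub>R u j + (2 / (real j + 2)) *\<^sub>R x j"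
      using assms(20) j by (simp add: field_simps)
    moreover have "0 \<le> 2 / (real j + 2) \<and> 2 / (real j + 2) \<le> 1" by simp
    ultimately show ?thesis
      using obj_cvx obj_x[OF j] unfolding convex_fun_def by (metis times_ereal.simps(1))
  qed
  have U: "prox_obj f h lam x0 (u j) = ereal (U j)" if "j \<ge> 1" for j
    using that
  proof (induction j rule: dec_induct)
    case base
    show ?case using obj_x[of 1] assms(19) by (simp add: U_def del: One_nat_def)
  next
    case (step j)
    have "prox_obj f h lam x0 (u (Suc j)) < \<infinity>"
      by (rule le_less_trans[OF obj_step[OF step(1)]]) (simp add: step.IH)
    then show ?case
      using obj_ninf[of "u (Suc j)"] unfolding U_def by (cases "prox_obj f h lam x0 (u (Suc j))") auto
  qed

  define g where "g j = U j + D j" for j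
  have step: "g (Suc j) \<le> real j / (real j + 2) * g j + (2 / (real j + 2))\<^sup>2 * (2 * lam * M\<^sup>2)"
    if j: "j \<ge> 1" for j
  proof -
    define c where "c = 2 / (real j + 2)"
    have c: "0 \<le> c" "c \<le> 1" by (auto simp: c_def)
    have "norm (z j - zb j) \<le> 2 * M"
      using norm_triangle_ineq4[of "z j" "zb j"] z[OF j] zb_sub(2)[OF j] by simp
    then have "(norm (z j - zb j))\<^sup>2 \<le> (2 * M)\<^sup>2" by (intro power_mono) auto
    then have "lam / 2 * (norm (z j - zb j))\<^sup>2 \<le> 2 * lam * M\<^sup>2"
      using lam by (simp add: power_mult_distrib)
    then have width: "c\<^sup>2 * (lam / 2 * (norm (z j - zb j))\<^sup>2) \<le> c\<^sup>2 * (2 * lam * M\<^sup>2)"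
      by (intro mult_left_mono) auto
    \<comment> \<open>The quadratic model is used at the weight with which \<open>x j\<close> enters \<open>u (Suc j)\<close>, so that the
      primal value at \<open>x j\<close> cancels when the two estimates are added.\<close>
    have "dual_obj f h lam x0 (z (Suc j))
        \<le> ereal (D j - c * (F j + a j - z j \<bullet> x j) + c\<^sup>2 * (lam / 2 * (norm (z j - zb j))\<^sup>2))"
      unfolding zSuc[OF j]
      using cg_weight_model_optimal(2)[OF fin(1) h lam pair[OF j] zb_sub(1)[OF j] F[OF j] _
          dual[OF j] weight[OF j] c] z[OF j] by blast
    then have "D (Suc j) \<le> D j - c * (F j + p j + D j) + c\<^sup>2 * (lam / 2 * (norm (z j - zb j))\<^sup>2)"
      using dual[of "Suc j"] by (simp add: D_def algebra_simps)
    moreover have "U (Suc j) \<le> (1 - c) * U j + c * (F j + p j)"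
      using obj_step[OF j] U[OF j] U[of "Suc j"] by (simp add: c_def)
    ultimately have "g (Suc j) \<le> (1 - c) * g j + c\<^sup>2 * (2 * lam * M\<^sup>2)"
      using width by (simp add: g_def algebra_simps)
    moreover have "1 - c = real j / (real j + 2)" by (simp add: c_def field_simps)
    ultimately show ?thesis by (simp add: c_def)
  qed

  have g1: "g 1 \<le> 4 * M * (3 * d0 + lam * M)"
  proof -
    obtain fy hy where fy: "f y = ereal fy" and hy: "h y = ereal hy"
      and ymin: "\<And>v. ereal (fy + hy) \<le> f v + h v"
      using Argmin_composite_finite[OF f h dom y] by blast
    have a1: "a 1 = f' x0 \<bullet> x0 - real_of_ereal (f x0)"
      using conjugate_at_subgradient[OF sub(1)[OF x0] ffin[OF x0]] by (simp add: a_def z1 del: One_nat_def)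
    have "U 1 = F 1 + p 1" using obj_x[of 1] assms(19) by (simp add: U_def del: One_nat_def)
    then have "g 1 = F 1 - real_of_ereal (f x0) - f' x0 \<bullet> (x 1 - x0)"
      by (simp add: g_def D_def a1 z1 inner_diff_right del: One_nat_def)
    also have "\<dots> \<le> 2 * M * (norm (y - x0) + 2 * lam * M)"
      using first_gap_bound[OF lam _ sub[OF x0] zb_sub[of 1] ffin[OF x0] F[of 1] fy hy ymin] pair[of 1]
      by (simp add: z1 del: One_nat_def)
    also have "\<dots> \<le> 2 * M * (2 * (3 * d0 + lam * M))"
      using yx0 d0 assms(5) by (intro mult_left_mono) auto
    finally show ?thesis by (simp add: algebra_simps)
  qed

  show ?thesis
  proof (intro allI impI)
    fix j :: nat assume j: "1 \<le> j"
    have "g j \<le> 2 * g 1 / (real j * (real j + 1)) + 4 * (2 * lam * M\<^sup>2) / (real j + 1)"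
      by (rule gap_recursion_bound[OF _ step j]) (use lam in simp)
    moreover have "2 * g 1 / (real j * (real j + 1)) \<le> 8 * M * (3 * d0 + lam * M) / (real j * (real j + 1))"
    proof (rule divide_right_mono)
      show "2 * g 1 \<le> 8 * M * (3 * d0 + lam * M)" using g1 by linarith
    qed simp
    ultimately show "prox_obj f h lam x0 (u j) + dual_obj f h lam x0 (z j)
        \<le> ereal (8 * M * (3 * d0 + lam * M) / (real j * (real j + 1)) + 8 * lam * M\<^sup>2 / (real j + 1))"
      by (simp add: U[OF j] dual[OF j] g_def)
  qed
qed

end
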